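(* Let $\mathcal L_0$ be the generator of an ergodic time-reversible Markov process with invariant probability measure $\pi$ on a Polish space $E$, let $\mathcal S$ be a reversible perturbation and $\mathcal A$ an irreversible perturbation (as defined in the context), and let $\mathcal L=\mathcal L_0+\mathcal S+\mathcal A$. Let $I$ and $I_o$ be the Donsker–Varadhan large deviation rate functions of the empirical measure of the processes with generators $\mathcal L$ and $\mathcal L_0$ respectively, and for $f\in\mathcal C^{(\alpha)}(E)$ set $$\tilde I_f(\ell)=\inf_{\mu\in\mathcal P(E)}\{I(\mu):\langle f,\mu\rangle=\ell\},\qquad \tilde I_{f,0}(\ell)=\inf_{\mu\in\mathcal P(E)}\{I_o(\mu):\langle f,\mu\rangle=\ell\}.$$ Then for every $f\in\mathcal C^{(\alpha)}(E)$ and every $\ell\in(\min_x f(x),\max_x f(x))$ with $\ell\neq\int f\,d\pi$, $$\tilde I_f(\ell)\ge\tilde I_{f,0}(\ell).$$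
   Context: $\mathcal P(E)$ is the space of probability measures on the Polish space $E$ with the weak topology; $\langle f,\mu\rangle=\int f\,d\mu$. $\mathcal C^{(\alpha)}(E)$ denotes the real-valued Hölder continuous functions of exponent $\alpha>0$ on $E$. $L^2_{\mathbb R}(\pi)$ has scalar product $\langle f,g\rangle=\int fg\,d\pi$. Reference process: the Markov process with generator $\mathcal L_0$ (domain $D(\mathcal L_0)\subset L^2_{\mathbb R}(\pi)$) is ergodic and reversible with invariant measure $\pi$, so $\mathcal L_0$ is self-adjoint; it has a spectral gap: there is $\lambda_0<0$ with $\sigma(\mathcal L_0)\setminus\{0\}\subset(-\infty,\lambda_0]$; in particular $\langle f,\mathcal L_0f\rangle\le0$. Reversible perturbation $\mathcal S$: $D(\mathcal L_0)\subset D(\mathcal S)$; $\mathcal L_0+\mathcal S$ is the (self-adjoint) generator of a Markov process with invariant measure $\pi$; $\mathcal S$ is self-adjoint; $\langle f,\mathcal S f\rangle\le0$ for all $f\in D(\mathcal S)$. Irreversible perturbation $\mathcal A$: $D(\mathcal L_0+\mathcal S)\subset D(\mathcal A)$; $\mathcal L=\mathcal L_0+\mathcal S+\mathcal A$ is the generator of a Markov process with invariant measure $\pi$; $\langle f,\mathcal A g\rangle=-\langle\mathcal A f,g\rangle$ for $f,g\in D(\mathcal A)$. Standing assumptions on large deviations: for each process involved the empirical measures $\mu_t=\frac1t\int_0^t\delta_{X(s)}\,ds$ satisfy a large deviation principle in $\mathcal P(E)$ as $t\to\infty$ (speed $t$) with rate function given by the Donsker–Varadhan formula $$I(\mu)=-\inf_{u>0,\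 u\in D(\mathcal L)}\int\frac{\mathcal L u}{u}\,d\mu ,$$ and when the generator is reversible (self-adjoint), such as $\mathcal L_0$ or $\mathcal L_0+\mathcal S$, the rate function is given by $$I_o(\mu)=\Big\langle\Big(\tfrac{d\mu}{d\pi}\Big)^{1/2},(-\mathcal L_0)\Big(\tfrac{d\mu}{d\pi}\Big)^{1/2}\Big\rangle$$ (with $\mathcal L_0$ replaced by the reversible generator in question). By the contraction principle $\tilde I_f$ is then the large deviation rate function of $\frac1t\int_0^tf(X(s))\,ds$. *)

theory Defs
  imports "HOL-Probability.Probability"
begin

section \<open>The real Hilbert space \<open>L\<^sup>2(\<pi>)\<close> and unbounded operators on it\<close>

text \<open>
  Elements of \<open>L\<^sup>2(\<pi>)\<close> are represented by square-integrable Borel functions, identified up to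
  \<open>\<pi>\<close>-null sets. An unbounded operator is represented by its graph, a relation on such functions
  that is closed under changing either component on a \<open>\<pi>\<close>-null set; its domain is \<^term>\<open>Domain T\<close>.
\<close>

type_synonym 'a l2op = "(('a \<Rightarrow> real) \<times> ('a \<Rightarrow> real)) set"

definition L2 :: "'a measure \<Rightarrow> ('a \<Rightarrow> real) set" where
  "L2 \<pi> = {f \<in> borel_measurable \<pi>. integrable \<pi> (\<lambda>x. (f x)\<^sup>2)}"

definition ip :: "'a measure \<Rightarrow> ('a \<Rightarrow> real) \<Rightarrow> ('a \<Rightarrow> real) \<Rightarrow> real" where
  "ip \<pi> f g = (\<integral>x. f x * g x \<partial>\<pi>)"

definition l2norm :: "'a measure \<Rightarrow> ('a \<Rightarrow> real) \<Rightarrow> real" where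
  "l2norm \<pi> f = sqrt (ip \<pi> f f)"

definition linear_op :: "'a measure \<Rightarrow> 'a l2op \<Rightarrow> bool" where
  "linear_op \<pi> T \<longleftrightarrow>
     T \<subseteq> L2 \<pi> \<times> L2 \<pi> \<and> T \<noteq> {} \<and>
     (\<forall>u v u' v' a b. (u, v) \<in> T \<longrightarrow> (u', v') \<in> T \<longrightarrow>
        (\<lambda>x. a * u x + b * u' x, \<lambda>x. a * v x + b * v' x) \<in> T) \<and>
     (\<forall>u v v'. (u, v) \<in> T \<longrightarrow> (u, v') \<in> T \<longrightarrow> (AE x in \<pi>. v x = v' x)) \<and>
     (\<forall>(u, v) \<in> T. \<forall>u' \<in> L2 \<pi>. \<forall>v' \<in> L2 \<pi>.
        (AE x in \<pi>. u x = u' x) \<longrightarrow> (AE x in \<pi>. v x = v' x) \<longrightarrow> (u', v') \<in> T)"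

definition op_sum :: "'a l2op \<Rightarrow> 'a l2op \<Rightarrow> 'a l2op" where
  "op_sum T U = {(u, \<lambda>x. v x + w x) | u v w. (u, v) \<in> T \<and> (u, w) \<in> U}"

definition densely_defined :: "'a measure \<Rightarrow> 'a l2op \<Rightarrow> bool" where
  "densely_defined \<pi> T \<longleftrightarrow> (\<forall>f \<in> L2 \<pi>. \<forall>e > 0. \<exists>u \<in> Domain T. l2norm \<pi> (\<lambda>x. f x - u x) < e)"

definition adjoint_op :: "'a measure \<Rightarrow> 'a l2op \<Rightarrow> 'a l2op" where
  "adjoint_op \<pi> T =
     {(g, h). g \<in> L2 \<pi> \<and> h \<in> L2 \<pi> \<and> (\<forall>(u, v) \<in> T. ip \<pi> v g = ip \<pi> u h)}"

definition self_adjoint :: "'a measure \<Rightarrow> 'a l2op \<Rightarrow> bool" where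
  "self_adjoint \<pi> T \<longleftrightarrow> linear_op \<pi> T \<and> densely_defined \<pi> T \<and> T = adjoint_op \<pi> T"

text \<open>
  Only real spectral parameters are considered; this is the whole spectrum for a self-adjoint
  operator, the only case in which it is used.
\<close>

definition spectrum :: "'a measure \<Rightarrow> 'a l2op \<Rightarrow> real set" where
  "spectrum \<pi> T = - {z.
     (\<forall>g \<in> L2 \<pi>. \<exists>(u, v) \<in> T. AE x in \<pi>. z * u x - v x = g x) \<and>
     (\<exists>C. \<forall>(u, v) \<in> T. l2norm \<pi> u \<le> C * l2norm \<pi> (\<lambda>x. z * u x - v x))}"

definition spectral_gap :: "'a measure \<Rightarrow> 'a l2op \<Rightarrow> bool" where
  "spectral_gap \<pi> T \<longleftrightarrow> (\<exists>l0 < 0. spectrum \<pi> T - {0} \<subseteq> {..l0})"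


section \<open>Markov processes and their generators\<close>

text \<open>
  Transition functions in the sense of Ethier and Kurtz: jointly measurable in time and space.
\<close>

definition transition_function :: "(real \<Rightarrow> 'a::polish_space \<Rightarrow> 'a measure) \<Rightarrow> bool" where
  "transition_function K \<longleftrightarrow>
     (\<lambda>(t, x). K t x) \<in> restrict_space borel {0..} \<Otimes>\<^sub>M borel \<rightarrow>\<^sub>M prob_algebra borel \<and>
     (\<forall>x. K 0 x = return borel x) \<and>
     (\<forall>s \<ge> 0. \<forall>t \<ge> 0. \<forall>x. K (s + t) x = K s x \<bind> K t)"

definition invariant_measure :: "'a measure \<Rightarrow> (real \<Rightarrow> 'a::polish_space \<Rightarrow> 'a measure) \<Rightarrow> bool" where
  "invariant_measure \<pi> K \<longleftrightarrow> prob_space \<pi> \<and> sets \<pi> = sets borel \<and> (\<forall>t \<ge> 0. \<pi> \<bind> K t = \<pi>)"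

definition semigroup :: "(real \<Rightarrow> 'a \<Rightarrow> 'a measure) \<Rightarrow> real \<Rightarrow> ('a \<Rightarrow> real) \<Rightarrow> 'a \<Rightarrow> real" where
  "semigroup K t f x = (\<integral>y. f y \<partial>K t x)"

definition strongly_continuous :: "'a measure \<Rightarrow> (real \<Rightarrow> 'a \<Rightarrow> 'a measure) \<Rightarrow> bool" where
  "strongly_continuous \<pi> K \<longleftrightarrow>
     (\<forall>f \<in> L2 \<pi>. ((\<lambda>t. l2norm \<pi> (\<lambda>x. semigroup K t f x - f x)) \<longlongrightarrow> 0) (at_right 0))"

definition generator :: "'a measure \<Rightarrow> (real \<Rightarrow> 'a \<Rightarrow> 'a measure) \<Rightarrow> 'a l2op" where
  "generator \<pi> K = {(u, v). u \<in> L2 \<pi> \<and> v \<in> L2 \<pi> \<and>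
     ((\<lambda>t. l2norm \<pi> (\<lambda>x. (semigroup K t u x - u x) / t - v x)) \<longlongrightarrow> 0) (at_right 0)}"

definition markov_generator ::
  "'a measure \<Rightarrow> (real \<Rightarrow> 'a::polish_space \<Rightarrow> 'a measure) \<Rightarrow> 'a l2op \<Rightarrow> bool" where
  "markov_generator \<pi> K L \<longleftrightarrow> transition_function K \<and> invariant_measure \<pi> K \<and>
     strongly_continuous \<pi> K \<and> L = generator \<pi> K"

definition reversible :: "'a measure \<Rightarrow> (real \<Rightarrow> 'a::polish_space \<Rightarrow> 'a measure) \<Rightarrow> bool" where
  "reversible \<pi> K \<longleftrightarrow> (\<forall>t \<ge> 0. \<forall>A \<in> sets borel. \<forall>B \<in> sets borel.
     (\<integral>x. indicator A x * measure (K t x) B \<partial>\<pi>) = (\<integral>x. indicator B x * measure (K t x) A \<partial>\<pi>))"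

definition ergodic :: "'a measure \<Rightarrow> (real \<Rightarrow> 'a::polish_space \<Rightarrow> 'a measure) \<Rightarrow> bool" where
  "ergodic \<pi> K \<longleftrightarrow> (\<forall>A \<in> sets borel.
     (\<forall>t \<ge> 0. AE x in \<pi>. measure (K t x) A = indicator A x) \<longrightarrow> measure \<pi> A = 0 \<or> measure \<pi> A = 1)"

text \<open>A measurable Markov process with transition function \<open>K\<close> and arbitrary initial law.\<close>

definition history :: "'w measure \<Rightarrow> (real \<Rightarrow> 'w \<Rightarrow> 'a::polish_space) \<Rightarrow> real \<Rightarrow> 'w measure" where
  "history M X s = sigma (space M) {X r -` B \<inter> space M | r B. 0 \<le> r \<and> r \<le> s \<and> B \<in> sets borel}"

definition markov_process ::
  "'w measure \<Rightarrow> (real \<Rightarrow> 'w \<Rightarrow> 'a::polish_space) \<Rightarrow> (real \<Rightarrow> 'a \<Rightarrow> 'a measure) \<Rightarrow> bool" where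
  "markov_process M X K \<longleftrightarrow>
     prob_space M \<and> transition_function K \<and>
     (\<lambda>(t, \<omega>). X t \<omega>) \<in> restrict_space borel {0..} \<Otimes>\<^sub>M M \<rightarrow>\<^sub>M borel \<and>
     (\<forall>s \<ge> 0. \<forall>t \<ge> 0. \<forall>B \<in> sets borel. AE \<omega> in M.
        real_cond_exp M (history M X s) (\<lambda>\<omega>'. indicator B (X (s + t) \<omega>')) \<omega> =
        measure (K t (X s \<omega>)) B)"


section \<open>Perturbations\<close>

definition reversible_perturbation :: "'a::polish_space measure \<Rightarrow> 'a l2op \<Rightarrow> 'a l2op \<Rightarrow> bool" where
  "reversible_perturbation \<pi> L0 S \<longleftrightarrow>
     Domain L0 \<subseteq> Domain S \<and>
     (\<exists>K. markov_generator \<pi> K (op_sum L0 S)) \<and> self_adjoint \<pi> (op_sum L0 S) \<and>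
     self_adjoint \<pi> S \<and>
     (\<forall>(u, v) \<in> S. ip \<pi> u v \<le> 0)"

text \<open>Here \<open>L\<close> is the reversible generator being perturbed.\<close>

definition irreversible_perturbation :: "'a::polish_space measure \<Rightarrow> 'a l2op \<Rightarrow> 'a l2op \<Rightarrow> bool" where
  "irreversible_perturbation \<pi> L A \<longleftrightarrow>
     linear_op \<pi> A \<and> Domain L \<subseteq> Domain A \<and>
     (\<exists>K. markov_generator \<pi> K (op_sum L A)) \<and>
     (\<forall>(f, f') \<in> A. \<forall>(g, g') \<in> A. ip \<pi> f g' = - ip \<pi> f' g)"


section \<open>Large deviations of empirical measures\<close>

definition PE :: "'a::polish_space measure set" where
  "PE = {\<mu>. prob_space \<mu> \<and> sets \<mu> = sets borel}"

definition weak_topology :: "'a::polish_space measure topology" where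
  "weak_topology = topology_generated_by
     {{\<mu> \<in> PE. (\<integral>x. h x \<partial>\<mu>) \<in> U} | h U.
        continuous_on UNIV h \<and> bounded (range h) \<and> open (U :: real set)}"

definition empirical_measure ::
  "(real \<Rightarrow> 'w \<Rightarrow> 'a::polish_space) \<Rightarrow> real \<Rightarrow> 'w \<Rightarrow> 'a measure" where
  "empirical_measure X t \<omega> =
     distr (scale_measure (ennreal (1 / t)) (restrict_space lborel {0..t})) borel (\<lambda>s. X s \<omega>)"

definition elog :: "real \<Rightarrow> ereal" where
  "elog p = (if p \<le> 0 then -\<infinity> else ereal (ln p))"

definition ldp ::
  "'w measure \<Rightarrow> (real \<Rightarrow> 'w \<Rightarrow> 'a::polish_space measure) \<Rightarrow> ('a measure \<Rightarrow> ereal) \<Rightarrow> bool" where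
  "ldp M Y J \<longleftrightarrow>
     (\<forall>\<mu> \<in> PE. 0 \<le> J \<mu>) \<and>
     (\<forall>c::real. closedin weak_topology {\<mu> \<in> PE. J \<mu> \<le> ereal c}) \<and>
     (\<forall>G. openin weak_topology G \<longrightarrow>
        - (INF \<mu>\<in>G. J \<mu>) \<le>
        Liminf at_top (\<lambda>t. ereal (1 / t) * elog (measure M {\<omega> \<in> space M. Y t \<omega> \<in> G}))) \<and>
     (\<forall>F. closedin weak_topology F \<longrightarrow>
        Limsup at_top (\<lambda>t. ereal (1 / t) * elog (measure M {\<omega> \<in> space M. Y t \<omega> \<in> F})) \<le>
        - (INF \<mu>\<in>F. J \<mu>))"

text \<open>
  Integral with values in the extended reals. Since \<^term>\<open>\<infinity> - \<infinity> = (\<infinity>::ereal)\<close>, functions for which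
  the integral is not defined never contribute to an infimum of such integrals.
\<close>

definition eintegral :: "'a measure \<Rightarrow> ('a \<Rightarrow> real) \<Rightarrow> ereal" where
  "eintegral \<mu> g = enn2ereal (\<integral>\<^sup>+x. ennreal (g x) \<partial>\<mu>) - enn2ereal (\<integral>\<^sup>+x. ennreal (- g x) \<partial>\<mu>)"

text \<open>
  The infimum runs over all versions \<open>u\<close>, \<open>v\<close> of \<open>u\<close> and \<open>L u\<close>. For \<open>\<mu> \<lless> \<pi>\<close> the integral does not depend
  on the version. If \<open>\<mu>\<close> charges a \<open>\<pi>\<close>-null set, taking \<open>u = 1\<close> and a very negative version of
  \<open>L 1 = 0\<close> on that set shows that the rate is \<open>\<infinity>\<close>, which is the usual convention.
\<close>

definition dv_rate :: "'a l2op \<Rightarrow> 'a measure \<Rightarrow> ereal" where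
  "dv_rate L \<mu> = - (INF (u, v)\<in>{(u, v) \<in> L. \<forall>x. 0 < u x}. eintegral \<mu> (\<lambda>x. v x / u x))"

text \<open>
  The closure of the form \<open>\<langle>f, -L f\<rangle>\<close>, \<open>f \<in> D(L)\<close>: it equals \<open>\<langle>f, -L f\<rangle>\<close> on \<open>D(L)\<close>, it equals
  the squared norm of \<open>(-L)\<^sup>1\<^sup>/\<^sup>2 f\<close> on the form domain, and it is \<open>\<infinity>\<close> elsewhere (infimum of the
  empty set). The set below has at most one element when \<open>L\<close> is self-adjoint and non-positive.
\<close>

definition form_closure :: "'a measure \<Rightarrow> 'a l2op \<Rightarrow> ('a \<Rightarrow> real) \<Rightarrow> ereal" where
  "form_closure \<pi> L f = Inf {ereal c | c. \<exists>u v.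
     (\<forall>n::nat. (u n, v n) \<in> L) \<and>
     (\<lambda>n. l2norm \<pi> (\<lambda>x. u n x - f x)) \<longlonglongrightarrow> 0 \<and>
     (\<forall>e > 0. \<exists>N. \<forall>m \<ge> N. \<forall>n \<ge> N.
        ip \<pi> (\<lambda>x. u n x - u m x) (\<lambda>x. - (v n x - v m x)) < e) \<and>
     (\<lambda>n. ip \<pi> (u n) (\<lambda>x. - v n x)) \<longlonglongrightarrow> c}"

definition reversible_rate :: "'a measure \<Rightarrow> 'a l2op \<Rightarrow> 'a measure \<Rightarrow> ereal" where
  "reversible_rate \<pi> L \<mu> =
     (if absolutely_continuous \<pi> \<mu>
      then form_closure \<pi> L (\<lambda>x. sqrt (enn2real (RN_deriv \<pi> \<mu> x))) else \<infinity>)"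

definition holder :: "real \<Rightarrow> ('a::metric_space \<Rightarrow> real) \<Rightarrow> bool" where
  "holder \<alpha> f \<longleftrightarrow> (\<exists>C. \<forall>x y. \<bar>f x - f y\<bar> \<le> C * dist x y powr \<alpha>)"

definition observable_rate ::
  "('a::polish_space measure \<Rightarrow> ereal) \<Rightarrow> ('a \<Rightarrow> real) \<Rightarrow> real \<Rightarrow> ereal" where
  "observable_rate J f l = (INF \<mu>\<in>{\<mu> \<in> PE. integrable \<mu> f \<and> (\<integral>x. f x \<partial>\<mu>) = l}. J \<mu>)"

end

theory Submission
  imports Defs
begin

text \<open>
  The rate functions are compared at every \<open>\<mu>\<close>. If \<open>\<mu>\<close> charges a \<open>\<pi>\<close>-null set, versions of \<open>L 1 = 0\<close> make
  the Donsker--Varadhan rate infinite. Otherwise put \<open>g = (d\<mu>/d\<pi>)\<^sup>1\<^sup>/\<^sup>2\<close> and \<open>u = r (r - L)\<inverse> g\<close>, where the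
  resolvent is the Laplace transform of the semigroup of \<open>L\<close>; thus \<open>u \<ge> 0\<close> and \<open>L u = r (u - g)\<close>. Testing the
  variational formula with \<open>u + \<epsilon>\<close> and letting \<open>\<epsilon>\<close> tend to \<open>0\<close> gives \<open>\<langle>u, -L u\<rangle> \<le> I(\<mu>)\<close>. As \<open>\<langle>u, A u\<rangle> = 0\<close>
  and \<open>\<langle>u, S u\<rangle> \<le> 0\<close>, also \<open>\<langle>u, -L0 u\<rangle> \<le> I(\<mu>)\<close>. Finally \<open>u\<close> tends to \<open>g\<close> as \<open>r\<close> tends to infinity, and the
  closed form of \<open>L0\<close> is lower semicontinuous.
\<close>

section \<open>Square-integrable functions and closed forms\<close>

text \<open>Putting \<open>u = g\<close> in the variational formula formally gives
  \<open><g, -L g>\<close>, but \<open>g\<close> need not lie in the domain of \<open>L\<close> and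
  may vanish. The resolvent repairs the first defect and, being an average of Markov kernels, keeps
  the sign; the shift by \<epsilon> repairs the second, since \<open>L\<close> annihilates
  constants. Moreover \<open>L u\<close> becomes an explicit multiple of \<open>u - g\<close>, so
  that passing from the weight \<open>g^2\<close> of the variational formula to the weight
  \<open>u^2\<close> of the energy is a matter of signs. The energy has to be split at
  \<open>u\<close> rather than at \<open>g\<close>: membership in the domain of the sum places
  \<open>u\<close> in the domains of \<open>L0\<close>, \<open>S\<close> and \<open>A\<close> at
  once.

  The resolvent is built without integrating \<open>L2\<close>-valued functions: kernels are
  averaged over an exponential time, and the memoryless property yields exact difference quotients.
  The resolvents only provide \<open>L2\<close> convergence with bounded \<open>L0\<close>-energy,
  whereas \<open>form_closure\<close> also asks the energies to converge; the convexity argument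
  closes this gap.\<close>

lemma L2_ip_integrable:
  assumes "f \<in> L2 \<pi>" "g \<in> L2 \<pi>"
  shows "integrable \<pi> (\<lambda>x. f x * g x)"
proof (rule Bochner_Integration.integrable_bound)
  show "integrable \<pi> (\<lambda>x. (f x)\<^sup>2 + (g x)\<^sup>2)" "(\<lambda>x. f x * g x) \<in> borel_measurable \<pi>"
    using assms by (auto simp: L2_def)
  have "\<bar>a * b\<bar> \<le> a\<^sup>2 + b\<^sup>2" for a b :: real
    using sum_squares_bound[of "\<bar>a\<bar>" "\<bar>b\<bar>"] mult_nonneg_nonneg[of "\<bar>a\<bar>" "\<bar>b\<bar>"]
    unfolding abs_mult power2_abs by linarith
  then show "AE x in \<pi>. norm (f x * g x) \<le> norm ((f x)\<^sup>2 + (g x)\<^sup>2)"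
    by simp
qed

lemma L2_lincomb:
  assumes "f \<in> L2 \<pi>" "g \<in> L2 \<pi>"
  shows "(\<lambda>x. a * f x + b * g x) \<in> L2 \<pi>"
proof -
  have "integrable \<pi> (\<lambda>x. a * a * (f x * f x) + (2 * a * b) * (f x * g x) + b * b * (g x * g x))"
    by (intro Bochner_Integration.integrable_add integrable_mult_right L2_ip_integrable assms)
  moreover have "(\<lambda>x. (a * f x + b * g x)\<^sup>2) =
      (\<lambda>x. a * a * (f x * f x) + (2 * a * b) * (f x * g x) + b * b * (g x * g x))"
    by (auto simp: power2_eq_square algebra_simps)
  ultimately show ?thesis using assms by (auto simp: L2_def)
qed

lemma L2_add: "f \<in> L2 \<pi> \<Longrightarrow> g \<in> L2 \<pi> \<Longrightarrow> (\<lambda>x. f x + g x) \<in> L2 \<pi>"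
  using L2_lincomb[of f \<pi> g 1 1] by simp

lemma L2_diff: "f \<in> L2 \<pi> \<Longrightarrow> g \<in> L2 \<pi> \<Longrightarrow> (\<lambda>x. f x - g x) \<in> L2 \<pi>"
  using L2_lincomb[of f \<pi> g 1 "-1"] by simp

lemma L2_cmult: "f \<in> L2 \<pi> \<Longrightarrow> (\<lambda>x. a * f x) \<in> L2 \<pi>"
  using L2_lincomb[of f \<pi> f a 0] by simp

lemma L2_divide: "f \<in> L2 \<pi> \<Longrightarrow> (\<lambda>x. f x / a) \<in> L2 \<pi>"
  using L2_cmult[of f \<pi> "1 / a"] by simp

lemma L2_measurable: "f \<in> L2 \<pi> \<Longrightarrow> f \<in> borel_measurable \<pi>"
  by (simp add: L2_def)

lemma L2_cong_AE:
  assumes "f \<in> L2 \<pi>" "g \<in> borel_measurable \<pi>" "AE x in \<pi>. f x = g x"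
  shows "g \<in> L2 \<pi>"
proof -
  have "integrable \<pi> (\<lambda>x. (f x)\<^sup>2) \<longleftrightarrow> integrable \<pi> (\<lambda>x. (g x)\<^sup>2)"
    using assms by (intro integrable_cong_AE) (auto simp: L2_def)
  then show ?thesis using assms by (simp add: L2_def)
qed

lemma ip_lincomb_left:
  assumes "f \<in> L2 \<pi>" "g \<in> L2 \<pi>" "h \<in> L2 \<pi>"
  shows "ip \<pi> (\<lambda>x. a * f x + b * g x) h = a * ip \<pi> f h + b * ip \<pi> g h"
proof -
  have "ip \<pi> (\<lambda>x. a * f x + b * g x) h = (\<integral>x. a * (f x * h x) + b * (g x * h x) \<partial>\<pi>)"
    unfolding ip_def by (simp add: algebra_simps)
  also have "\<dots> = a * ip \<pi> f h + b * ip \<pi> g h"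
    using L2_ip_integrable[OF assms(1,3)] L2_ip_integrable[OF assms(2,3)] by (simp add: ip_def)
  finally show ?thesis .
qed

lemma ip_commute: "ip \<pi> f g = ip \<pi> g f"
  by (simp add: ip_def mult.commute)

lemma ip_lincomb_right:
  assumes "f \<in> L2 \<pi>" "g \<in> L2 \<pi>" "h \<in> L2 \<pi>"
  shows "ip \<pi> h (\<lambda>x. a * f x + b * g x) = a * ip \<pi> h f + b * ip \<pi> h g"
  using ip_lincomb_left[OF assms] by (simp add: ip_commute)

lemma ip_minus_right: "ip \<pi> f (\<lambda>x. - g x) = - ip \<pi> f g"
  by (simp add: ip_def)

lemma ip_self_nonneg: "0 \<le> ip \<pi> f f"
  by (simp add: ip_def)

lemma l2norm_nonneg: "0 \<le> l2norm \<pi> f"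
  by (simp add: l2norm_def ip_self_nonneg)

lemma l2norm_sq: "(l2norm \<pi> f)\<^sup>2 = ip \<pi> f f"
  by (simp add: l2norm_def ip_self_nonneg)

lemma nn_integral_sq_eq:
  assumes "f \<in> L2 \<pi>"
  shows "(\<integral>\<^sup>+x. ennreal ((f x)\<^sup>2) \<partial>\<pi>) = ennreal ((l2norm \<pi> f)\<^sup>2)"
proof -
  have "(\<integral>\<^sup>+x. ennreal ((f x)\<^sup>2) \<partial>\<pi>) = ennreal (\<integral>x. (f x)\<^sup>2 \<partial>\<pi>)"
    using assms by (intro nn_integral_eq_integral) (auto simp: L2_def)
  then show ?thesis unfolding l2norm_sq ip_def by (simp add: power2_eq_square)
qed

text \<open>Cauchy-Schwarz, obtained from its version for nonnegative integrals applied to the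
  absolute values.\<close>

lemma ip_le_l2norm:
  assumes f: "f \<in> L2 \<pi>" and g: "g \<in> L2 \<pi>"
  shows "\<bar>ip \<pi> f g\<bar> \<le> l2norm \<pi> f * l2norm \<pi> g"
proof -
  note [measurable] = L2_measurable[OF f] L2_measurable[OF g]
  have "ennreal \<bar>ip \<pi> f g\<bar> \<le> (\<integral>\<^sup>+x. ennreal \<bar>f x\<bar> * ennreal \<bar>g x\<bar> \<partial>\<pi>)"
    using integral_norm_bound_ennreal[OF L2_ip_integrable[OF f g]]
    by (simp add: ip_def abs_mult ennreal_mult)
  then have "(ennreal \<bar>ip \<pi> f g\<bar>)\<^sup>2 \<le> (\<integral>\<^sup>+x. ennreal \<bar>f x\<bar> * ennreal \<bar>g x\<bar> \<partial>\<pi>)\<^sup>2"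
    by (intro power_mono) auto
  also have "\<dots> \<le> (\<integral>\<^sup>+x. (ennreal \<bar>f x\<bar>)\<^sup>2 \<partial>\<pi>) * (\<integral>\<^sup>+x. (ennreal \<bar>g x\<bar>)\<^sup>2 \<partial>\<pi>)"
    by (intro Cauchy_Schwarz_nn_integral) auto
  also have "\<dots> = ennreal ((l2norm \<pi> f)\<^sup>2 * (l2norm \<pi> g)\<^sup>2)"
    using nn_integral_sq_eq[OF f] nn_integral_sq_eq[OF g]
    by (simp add: ennreal_power ennreal_mult)
  finally have "\<bar>ip \<pi> f g\<bar>\<^sup>2 \<le> (l2norm \<pi> f * l2norm \<pi> g)\<^sup>2"
    by (simp add: ennreal_power power_mult_distrib)
  then show ?thesis
    by (rule power2_le_imp_le) (simp add: l2norm_nonneg)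
qed

lemma l2norm_triangle:
  assumes f: "f \<in> L2 \<pi>" and g: "g \<in> L2 \<pi>"
  shows "l2norm \<pi> (\<lambda>x. f x + g x) \<le> l2norm \<pi> f + l2norm \<pi> g"
proof (rule power2_le_imp_le)
  have fg: "(\<lambda>x. f x + g x) \<in> L2 \<pi>" using L2_add[OF f g] .
  have "(l2norm \<pi> (\<lambda>x. f x + g x))\<^sup>2 = ip \<pi> f f + 2 * ip \<pi> f g + ip \<pi> g g"
    using ip_lincomb_left[OF f g fg, of 1 1] ip_lincomb_right[OF f g f, of 1 1]
      ip_lincomb_right[OF f g g, of 1 1] ip_commute[of \<pi> f g]
    by (simp add: l2norm_sq)
  also have "\<dots> \<le> (l2norm \<pi> f + l2norm \<pi> g)\<^sup>2"
    using ip_le_l2norm[OF f g] by (simp add: power2_sum l2norm_sq)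
  finally show "(l2norm \<pi> (\<lambda>x. f x + g x))\<^sup>2 \<le> (l2norm \<pi> f + l2norm \<pi> g)\<^sup>2" .
qed (simp add: l2norm_nonneg)

lemma l2norm_cmult: "l2norm \<pi> (\<lambda>x. a * f x) = \<bar>a\<bar> * l2norm \<pi> f"
proof -
  have "ip \<pi> (\<lambda>x. a * f x) (\<lambda>x. a * f x) = a\<^sup>2 * ip \<pi> f f"
    unfolding ip_def integral_mult_right_zero[symmetric]
    by (simp add: power2_eq_square mult_ac)
  then show ?thesis by (simp add: l2norm_def real_sqrt_mult)
qed

lemma l2norm_lincomb_le:
  assumes "f \<in> L2 \<pi>" "g \<in> L2 \<pi>"
  shows "l2norm \<pi> (\<lambda>x. a * f x + b * g x) \<le> \<bar>a\<bar> * l2norm \<pi> f + \<bar>b\<bar> * l2norm \<pi> g"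
  using l2norm_triangle[OF L2_cmult[OF assms(1)] L2_cmult[OF assms(2)]]
  by (simp add: l2norm_cmult)

lemma l2norm_cong_AE:
  assumes "f \<in> borel_measurable \<pi>" "g \<in> borel_measurable \<pi>" "AE x in \<pi>. f x = g x"
  shows "l2norm \<pi> f = l2norm \<pi> g"
proof -
  have "ip \<pi> f f = ip \<pi> g g"
    unfolding ip_def using assms by (intro integral_cong_AE) auto
  then show ?thesis by (simp add: l2norm_def)
qed

text \<open>
  Convexity of the form replaces the usual weak compactness argument: near-minimisers of the energy
  over the shrinking balls around \<open>g\<close> are energy-Cauchy by the parallelogram identity, which holds
  without symmetry of \<open>T\<close>.
\<close>

lemma form_closure_le:
  assumes T: "T \<subseteq> L2 \<pi> \<times> L2 \<pi>"
    and lin: "\<And>u v u' v' a b. (u, v) \<in> T \<Longrightarrow> (u', v') \<in> T \<Longrightarrow>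
        (\<lambda>x. a * u x + b * u' x, \<lambda>x. a * v x + b * v' x) \<in> T"
    and diss: "\<And>u v. (u, v) \<in> T \<Longrightarrow> ip \<pi> u v \<le> 0"
    and g: "g \<in> L2 \<pi>"
    and appr: "\<And>e. 0 < e \<Longrightarrow> \<exists>u v. (u, v) \<in> T \<and> l2norm \<pi> (\<lambda>x. u x - g x) \<le> e \<and> - ip \<pi> u v \<le> c"
  shows "form_closure \<pi> T g \<le> ereal c"
proof -
  define E where "E = (\<lambda>(u, v). - ip \<pi> u v)"
  define C where "C n = {(u, v) \<in> T. l2norm \<pi> (\<lambda>x. u x - g x) \<le> 1 / real (Suc n)}" for n
  \<comment> \<open>The balls \<open>C n\<close> shrink, so \<open>d\<close> increases; it stays
    below \<open>c\<close>. Its limit \<open>D\<close> is the relaxed energy of \<open>g\<close>,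
    realised by near-minimisers \<open>p n\<close>.\<close>
  define d where "d n = Inf (E ` C n)" for n
  have E0: "0 \<le> E p" if "p \<in> T" for p using diss that by (auto simp: E_def split: prod.splits)
  have CT: "C n \<subseteq> T" for n by (auto simp: C_def)
  have bdd: "bdd_below (E ` C n)" for n
    using E0 CT by (intro bdd_belowI[of _ 0]) blast
  have ex: "\<exists>p \<in> C n. E p \<le> c" for n
    using appr[of "1 / real (Suc n)"] by (auto simp: C_def E_def)
  have Cmono: "C m \<subseteq> C n" if "n \<le> m" for n m
  proof -
    have "1 / real (Suc m) \<le> 1 / real (Suc n)" using that by (intro divide_left_mono) auto
    then show ?thesis by (auto simp: C_def)
  qed
  have dle: "d n \<le> E p" if "p \<in> C n" for n p
    unfolding d_def using bdd that by (intro cInf_lower) auto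
  have dc: "d n \<le> c" for n using ex[of n] dle by (meson order_trans)
  have "incseq d"
    unfolding incseq_def d_def using ex bdd by (intro allI impI cInf_superset_mono image_mono Cmono) blast+
  then obtain D where D: "d \<longlonglongrightarrow> D"
    using dc by (metis incseq_convergent)
  have Dc: "D \<le> c" using D dc by (intro LIMSEQ_le_const2[OF D]) auto
  have "\<exists>p \<in> C n. E p < d n + 1 / real (Suc n)" for n
  proof -
    have "\<exists>y\<in>E ` C n. y < d n + 1 / real (Suc n)"
      unfolding d_def using ex[of n] by (intro cInf_lessD) auto
    then show ?thesis by auto
  qed
  then obtain p where p: "\<And>n. p n \<in> C n" and Ep: "\<And>n. E (p n) < d n + 1 / real (Suc n)"
    by metis
  define u where "u n = fst (p n)" for n
  define v where "v n = snd (p n)" for n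
  have puv: "p n = (u n, v n)" for n by (simp add: u_def v_def)
  have uvT: "(u n, v n) \<in> T" for n using p[of n] by (auto simp: C_def puv)
  have uL: "u n \<in> L2 \<pi>" and vL: "v n \<in> L2 \<pi>" for n using uvT[of n] T by auto
  have lim0: "(\<lambda>n. 1 / real (Suc n)) \<longlonglongrightarrow> 0"
    using LIMSEQ_Suc[OF lim_1_over_n] by simp
  have Elim: "(\<lambda>n. E (p n)) \<longlonglongrightarrow> D"
  proof (rule tendsto_sandwich[OF _ _ D])
    show "(\<lambda>n. d n + 1 / real (Suc n)) \<longlonglongrightarrow> D"
      using tendsto_add[OF D lim0] by simp
  qed (use dle[OF p] less_imp_le[OF Ep] in \<open>simp_all add: always_eventually del: of_nat_Suc\<close>)
  \<comment> \<open>Parallelogram identity: the energy of the difference is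
    \<open>2 * E (p n) + 2 * E (p m)\<close> minus four times the energy of the midpoint. Balls are
    convex, so the midpoint is in \<open>C N\<close> and its energy is at least
    \<open>d N\<close>.\<close>
  have cau: "E (\<lambda>x. u n x - u m x, \<lambda>x. v n x - v m x) \<le> 2 * E (p n) + 2 * E (p m) - 4 * d N"
    if "N \<le> n" "N \<le> m" for n m N
  proof -
    have Cn: "(u n, v n) \<in> C N" "(u m, v m) \<in> C N"
      using p[of n] p[of m] Cmono that by (auto simp: puv)
    have "(\<lambda>x. 1/2 * u n x + 1/2 * u m x, \<lambda>x. 1/2 * v n x + 1/2 * v m x) \<in> T"
      using lin[OF uvT uvT] .
    moreover have "l2norm \<pi> (\<lambda>x. (1/2 * u n x + 1/2 * u m x) - g x) \<le> 1 / real (Suc N)"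
    proof -
      have "(\<lambda>x. (1/2 * u n x + 1/2 * u m x) - g x) = (\<lambda>x. 1/2 * (u n x - g x) + 1/2 * (u m x - g x))"
        by (auto simp: field_simps)
      then have "l2norm \<pi> (\<lambda>x. (1/2 * u n x + 1/2 * u m x) - g x) \<le>
          1/2 * l2norm \<pi> (\<lambda>x. u n x - g x) + 1/2 * l2norm \<pi> (\<lambda>x. u m x - g x)"
        using l2norm_lincomb_le[OF L2_diff[OF uL g] L2_diff[OF uL g], of "1/2" n "1/2" m] by simp
      also have "\<dots> \<le> 1 / real (Suc N)" using Cn by (auto simp: C_def)
      finally show ?thesis .
    qed
    ultimately have mid: "(\<lambda>x. 1/2 * u n x + 1/2 * u m x, \<lambda>x. 1/2 * v n x + 1/2 * v m x) \<in> C N"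
      by (auto simp: C_def)
    \<comment> \<open>Used with coefficients (1/2, 1/2) and (1, -1). The mixed terms enter with
      opposite signs and cancel, whether or not they are equal to each other.\<close>
    have lc: "ip \<pi> (\<lambda>x. a * u n x + b * u m x) (\<lambda>x. a * v n x + b * v m x) =
        a * a * ip \<pi> (u n) (v n) + a * b * ip \<pi> (u n) (v m) + b * a * ip \<pi> (u m) (v n)
        + b * b * ip \<pi> (u m) (v m)" for a b
      using ip_lincomb_left[OF uL uL L2_lincomb[OF vL vL]] ip_lincomb_right[OF vL vL uL]
      by (simp add: algebra_simps)
    show ?thesis
      using dle[OF mid] lc[of "1/2" "1/2"] lc[of 1 "-1"] unfolding E_def puv by simp
  qed
  have cauchy: "\<exists>N. \<forall>m\<ge>N. \<forall>n\<ge>N. ip \<pi> (\<lambda>x. u n x - u m x) (\<lambda>x. - (v n x - v m x)) < e"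
    if "0 < e" for e
  proof -
    \<comment> \<open>The bound in \<open>cau\<close> has coefficients 2, 2 and -4, whose absolute
      values add up to 8, and the terms in \<open>D\<close> cancel.\<close>
    have e8: "0 < e / 8" using that by simp
    obtain N1 where N1: "\<And>n. n \<ge> N1 \<Longrightarrow> \<bar>E (p n) - D\<bar> < e / 8"
      using LIMSEQ_D[OF Elim e8] unfolding real_norm_def by blast
    obtain N2 where N2: "\<And>n. n \<ge> N2 \<Longrightarrow> \<bar>d n - D\<bar> < e / 8"
      using LIMSEQ_D[OF D e8] unfolding real_norm_def by blast
    show ?thesis
    proof (intro exI[of _ "max N1 N2"] allI impI)
      fix m n assume mn: "max N1 N2 \<le> m" "max N1 N2 \<le> n"
      have "E (\<lambda>x. u n x - u m x, \<lambda>x. v n x - v m x) < e"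
        using cau[OF mn(2,1)] N1[of m] N1[of n] N2[of "max N1 N2"] mn by (simp add: abs_if split: if_splits)
      then show "ip \<pi> (\<lambda>x. u n x - u m x) (\<lambda>x. - (v n x - v m x)) < e"
        by (simp only: E_def ip_minus_right prod.case)
    qed
  qed
  have conv: "(\<lambda>n. l2norm \<pi> (\<lambda>x. u n x - g x)) \<longlonglongrightarrow> 0"
  proof (rule tendsto_sandwich[OF _ _ tendsto_const lim0])
    show "\<forall>\<^sub>F n in sequentially. l2norm \<pi> (\<lambda>x. u n x - g x) \<le> 1 / real (Suc n)"
      using p by (auto simp: C_def puv)
  qed (auto simp: l2norm_nonneg)
  have "form_closure \<pi> T g \<le> ereal D"
    unfolding form_closure_def
  proof (rule Inf_lower, rule CollectI, rule exI[of _ D], rule conjI[OF refl], rule exI[of _ u],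
      rule exI[of _ v], intro conjI)
    show "\<forall>n. (u n, v n) \<in> T" using uvT by simp
    show "(\<lambda>n. l2norm \<pi> (\<lambda>x. u n x - g x)) \<longlonglongrightarrow> 0" by (rule conv)
    show "\<forall>e>0. \<exists>N. \<forall>m\<ge>N. \<forall>n\<ge>N. ip \<pi> (\<lambda>x. u n x - u m x) (\<lambda>x. - (v n x - v m x)) < e"
      using cauchy by blast
    show "(\<lambda>n. ip \<pi> (u n) (\<lambda>x. - v n x)) \<longlonglongrightarrow> D"
      using Elim by (simp add: E_def puv ip_minus_right)
  qed
  also have "\<dots> \<le> ereal c" using Dc by simp
  finally show ?thesis .
qed

section \<open>Markov kernels with an invariant measure\<close>

text \<open>Jensen for the square, by Cauchy-Schwarz against the constant 1. If \<open>f\<close> is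
  not integrable, its Bochner integral is 0 by convention and the bound is trivial.\<close>

lemma (in prob_space) integral_sq_le_nn_integral:
  assumes [measurable]: "f \<in> borel_measurable M"
  shows "ennreal ((\<integral>x. f x \<partial>M)\<^sup>2) \<le> (\<integral>\<^sup>+x. ennreal ((f x)\<^sup>2) \<partial>M)"
proof (cases "integrable M f")
  case True
  have "(ennreal \<bar>\<integral>x. f x \<partial>M\<bar>)\<^sup>2 \<le> (\<integral>\<^sup>+x. ennreal \<bar>f x\<bar> * 1 \<partial>M)\<^sup>2"
    using integral_norm_bound_ennreal[OF True] by (intro power_mono) auto
  also have "\<dots> \<le> (\<integral>\<^sup>+x. (ennreal \<bar>f x\<bar>)\<^sup>2 \<partial>M) * (\<integral>\<^sup>+x. 1\<^sup>2 \<partial>M)"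
    by (intro Cauchy_Schwarz_nn_integral) auto
  finally show ?thesis by (simp add: ennreal_power emeasure_space_1)
qed (simp add: not_integrable_integral_eq)

text \<open>Isolates one Markov kernel preserving \<open>\<pi>\<close>. It is instantiated both by
  \<open>K t\<close> and by averages of these kernels over a random time, so that the contraction
  and almost-everywhere facts serve both.\<close>

locale invariant_kernel = prob_space \<pi> for \<pi> :: "'a::topological_space measure" +
  fixes k :: "'a \<Rightarrow> 'a measure"
  assumes sets_pi [measurable_cong, simp]: "sets \<pi> = sets borel"
    and k [measurable]: "k \<in> borel \<rightarrow>\<^sub>M prob_algebra borel"
    and invariant: "\<pi> \<bind> k = \<pi>"
begin

lemma prob_space_k: "prob_space (k x)" and sets_k [simp, measurable_cong]: "sets (k x) = sets borel"
  using measurable_space[OF k, of x] by (auto simp: space_prob_algebra)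

lemma space_k [simp]: "space (k x) = UNIV" and space_pi [simp]: "space \<pi> = UNIV"
  using sets_eq_imp_space_eq[OF sets_k] sets_eq_imp_space_eq[OF sets_pi] by auto

lemma k_subprob [measurable]: "k \<in> borel \<rightarrow>\<^sub>M subprob_algebra borel"
  by (rule measurable_prob_algebraD[OF k])

lemma borel_measurable_k [simp]: "borel_measurable (k x) = borel_measurable borel"
  and borel_measurable_pi [simp]: "borel_measurable \<pi> = borel_measurable borel"
  by (auto intro!: measurable_cong_sets)

lemma k_subprob_pi: "k \<in> \<pi> \<rightarrow>\<^sub>M subprob_algebra borel"
  using k_subprob unfolding measurable_cong_sets[OF sets_pi refl] .

lemma nn_integral_k:
  assumes "f \<in> borel_measurable borel"
  shows "(\<integral>\<^sup>+x. \<integral>\<^sup>+y. f y \<partial>k x \<partial>\<pi>) = (\<integral>\<^sup>+x. f x \<partial>\<pi>)"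
  using nn_integral_bind[OF assms k_subprob_pi] invariant by simp

text \<open>By invariance a \<open>\<pi>\<close>-null set \<open>N\<close> satisfies
  \<open>\<integral> k x N d\<pi> = 0\<close>. This lets identities between representatives survive
  an application of the kernel.\<close>

lemma AE_k:
  assumes "AE x in \<pi>. P x"
  shows "AE x in \<pi>. AE y in k x. P y"
proof -
  obtain N where N: "N \<in> sets \<pi>" "{x. \<not> P x} \<subseteq> N" "emeasure \<pi> N = 0"
    using assms by (auto elim!: AE_E)
  have "(\<integral>\<^sup>+x. emeasure (k x) N \<partial>\<pi>) = 0"
    using nn_integral_k[of "indicator N"] N by simp
  moreover have "(\<lambda>x. emeasure (k x) N) \<in> borel_measurable borel"
    using N by (intro measurable_compose[OF k_subprob measurable_emeasure_subprob_algebra]) simp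
  ultimately have "AE x in \<pi>. emeasure (k x) N = 0"
    by (simp add: nn_integral_0_iff_AE)
  then show ?thesis
  proof eventually_elim
    case (elim x)
    then show ?case using N by (intro AE_I[of _ _ N]) auto
  qed
qed

lemma op_measurable [measurable]:
  fixes f :: "'a \<Rightarrow> real"
  assumes "f \<in> borel_measurable borel"
  shows "(\<lambda>x. \<integral>y. f y \<partial>k x) \<in> borel_measurable borel"
  using integral_measurable_subprob_algebra[OF assms] k_subprob by measurable

text \<open>Jensen under each \<open>k x\<close>, then invariance to integrate over
  \<open>x\<close>.\<close>

lemma
  assumes f: "f \<in> L2 \<pi>"
  shows op_L2: "(\<lambda>x. \<integral>y. f y \<partial>k x) \<in> L2 \<pi>"
    and op_contraction: "l2norm \<pi> (\<lambda>x. \<integral>y. f y \<partial>k x) \<le> l2norm \<pi> f"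
proof -
  have [measurable]: "f \<in> borel_measurable borel" using L2_measurable[OF f] by simp
  have "(\<integral>\<^sup>+x. ennreal ((\<integral>y. f y \<partial>k x)\<^sup>2) \<partial>\<pi>) \<le> (\<integral>\<^sup>+x. \<integral>\<^sup>+y. ennreal ((f y)\<^sup>2) \<partial>k x \<partial>\<pi>)"
    by (intro nn_integral_mono prob_space.integral_sq_le_nn_integral prob_space_k) simp
  also have "\<dots> = (\<integral>\<^sup>+x. ennreal ((f x)\<^sup>2) \<partial>\<pi>)"
    by (rule nn_integral_k) simp
  also have "\<dots> = ennreal ((l2norm \<pi> f)\<^sup>2)" by (rule nn_integral_sq_eq[OF f])
  finally have le: "(\<integral>\<^sup>+x. ennreal ((\<integral>y. f y \<partial>k x)\<^sup>2) \<partial>\<pi>) \<le> ennreal ((l2norm \<pi> f)\<^sup>2)" .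
  show L2: "(\<lambda>x. \<integral>y. f y \<partial>k x) \<in> L2 \<pi>"
    unfolding L2_def using le_less_trans[OF le ennreal_less_top]
    by (auto intro!: integrableI_nonneg)
  show "l2norm \<pi> (\<lambda>x. \<integral>y. f y \<partial>k x) \<le> l2norm \<pi> f"
    using le unfolding nn_integral_sq_eq[OF L2]
    by (simp add: l2norm_nonneg power_mono_iff)
qed

text \<open>Integrals that diverge have the default value 0, which would break linearity of the
  kernel operator; invariance confines this to a null set of starting points.\<close>

lemma AE_integrable_k:
  assumes f: "f \<in> L2 \<pi>"
  shows "AE x in \<pi>. integrable (k x) f"
proof -
  have [measurable]: "f \<in> borel_measurable borel" using L2_measurable[OF f] by simp
  have "(\<integral>\<^sup>+x. \<integral>\<^sup>+y. ennreal ((f y)\<^sup>2) \<partial>k x \<partial>\<pi>) = ennreal ((l2norm \<pi> f)\<^sup>2)"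
    by (simp add: nn_integral_k nn_integral_sq_eq[OF f])
  then have "AE x in \<pi>. (\<integral>\<^sup>+y. ennreal ((f y)\<^sup>2) \<partial>k x) \<noteq> \<infinity>"
    by (intro nn_integral_noteq_infinite) auto
  then show ?thesis
  proof eventually_elim
    case (elim x)
    interpret kx: prob_space "k x" by (rule prob_space_k)
    have "integrable (k x) (\<lambda>y. (f y)\<^sup>2)"
      using elim by (intro integrableI_nonneg) (auto simp: less_top)
    then show ?case by (rule kx.square_integrable_imp_integrable[rotated]) simp
  qed
qed

lemma op_lincomb_AE:
  assumes "f \<in> L2 \<pi>" "g \<in> L2 \<pi>"
  shows "AE x in \<pi>. (\<integral>y. a * f y + b * g y \<partial>k x) = a * (\<integral>y. f y \<partial>k x) + b * (\<integral>y. g y \<partial>k x)"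
  using AE_integrable_k[OF assms(1)] AE_integrable_k[OF assms(2)] by eventually_elim simp

lemma ip_op_le:
  assumes f: "f \<in> L2 \<pi>"
  shows "ip \<pi> f (\<lambda>x. \<integral>y. f y \<partial>k x) \<le> ip \<pi> f f"
proof -
  have "ip \<pi> f (\<lambda>x. \<integral>y. f y \<partial>k x) \<le> l2norm \<pi> f * l2norm \<pi> (\<lambda>x. \<integral>y. f y \<partial>k x)"
    using ip_le_l2norm[OF f op_L2[OF f]] by simp
  also have "\<dots> \<le> l2norm \<pi> f * l2norm \<pi> f"
    using op_contraction[OF f] by (intro mult_left_mono) (auto simp: l2norm_nonneg)
  finally show ?thesis by (simp add: l2norm_sq flip: power2_eq_square)
qed

end

section \<open>The generator of a Markov semigroup\<close>

locale markov_semigroup =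
  fixes \<pi> :: "'a::polish_space measure" and K :: "real \<Rightarrow> 'a \<Rightarrow> 'a measure"
  assumes trans: "transition_function K" and inv: "invariant_measure \<pi> K"
begin

sublocale prob_space \<pi>
  using inv by (simp add: invariant_measure_def)

lemma sets_pi [measurable_cong, simp]: "sets \<pi> = sets borel"
  using inv by (simp add: invariant_measure_def)

lemma space_pi [simp]: "space \<pi> = UNIV"
  using sets_eq_imp_space_eq[OF sets_pi] by simp

lemma borel_measurable_pi [simp]: "borel_measurable \<pi> = borel_measurable borel"
  by (auto intro!: measurable_cong_sets)

text \<open>Transition functions are unconstrained at negative times, hence the truncation \<open>max 0 s\<close>.\<close>

lemma K_joint: "(\<lambda>(s, x). K (max 0 s) x) \<in> borel \<Otimes>\<^sub>M borel \<rightarrow>\<^sub>M prob_algebra borel"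
proof -
  have "(\<lambda>p. (max 0 (fst p), snd p)) \<in> borel \<Otimes>\<^sub>M borel \<rightarrow>\<^sub>M restrict_space borel {0::real..} \<Otimes>\<^sub>M (borel :: 'a measure)"
    by (intro measurable_Pair measurable_restrict_space2) (auto intro!: borel_measurable_max measurable_fst)
  moreover have "(\<lambda>(t, x). K t x) \<in> restrict_space borel {0..} \<Otimes>\<^sub>M borel \<rightarrow>\<^sub>M prob_algebra borel"
    using trans by (simp add: transition_function_def)
  ultimately have "(\<lambda>p. case (max 0 (fst p), snd p) of (t, x) \<Rightarrow> K t x) \<in> borel \<Otimes>\<^sub>M borel \<rightarrow>\<^sub>M prob_algebra borel"
    by (rule measurable_compose)
  then show ?thesis by (simp add: split_beta')
qed

lemma K_joint_measurable [measurable (raw)]: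
  assumes "t \<in> M \<rightarrow>\<^sub>M borel" "g \<in> M \<rightarrow>\<^sub>M borel"
  shows "(\<lambda>x. K (max 0 (t x)) (g x)) \<in> M \<rightarrow>\<^sub>M prob_algebra borel"
  using measurable_compose[OF measurable_Pair[OF assms] K_joint] by simp

lemma invariant_kernel_K:
  assumes "0 \<le> t" shows "invariant_kernel \<pi> (K t)"
proof
  have "(\<lambda>x. K (max 0 t) x) \<in> borel \<rightarrow>\<^sub>M prob_algebra borel" by measurable
  then show "K t \<in> borel \<rightarrow>\<^sub>M prob_algebra borel" using assms by simp
  show "\<pi> \<bind> K t = \<pi>" using inv assms by (simp add: invariant_measure_def)
qed simp

lemma
  assumes "0 \<le> t"
  shows semigroup_L2: "f \<in> L2 \<pi> \<Longrightarrow> semigroup K t f \<in> L2 \<pi>"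
    and semigroup_contraction: "f \<in> L2 \<pi> \<Longrightarrow> l2norm \<pi> (semigroup K t f) \<le> l2norm \<pi> f"
    and semigroup_ip_le: "f \<in> L2 \<pi> \<Longrightarrow> ip \<pi> f (semigroup K t f) \<le> ip \<pi> f f"
    and semigroup_lincomb_AE: "f \<in> L2 \<pi> \<Longrightarrow> g \<in> L2 \<pi> \<Longrightarrow>
      AE x in \<pi>. semigroup K t (\<lambda>x. a * f x + b * g x) x = a * semigroup K t f x + b * semigroup K t g x"
proof -
  interpret kt: invariant_kernel \<pi> "K t" by (rule invariant_kernel_K[OF assms])
  have eq: "semigroup K t f = (\<lambda>x. \<integral>y. f y \<partial>K t x)" for f by (simp add: semigroup_def fun_eq_iff)
  show "f \<in> L2 \<pi> \<Longrightarrow> semigroup K t f \<in> L2 \<pi>"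
    "f \<in> L2 \<pi> \<Longrightarrow> l2norm \<pi> (semigroup K t f) \<le> l2norm \<pi> f"
    "f \<in> L2 \<pi> \<Longrightarrow> ip \<pi> f (semigroup K t f) \<le> ip \<pi> f f"
    "f \<in> L2 \<pi> \<Longrightarrow> g \<in> L2 \<pi> \<Longrightarrow>
      AE x in \<pi>. semigroup K t (\<lambda>x. a * f x + b * g x) x = a * semigroup K t f x + b * semigroup K t g x"
    unfolding eq using kt.op_L2 kt.op_contraction kt.ip_op_le kt.op_lincomb_AE by blast+
qed

lemma difference_quotient_L2:
  "0 \<le> t \<Longrightarrow> u \<in> L2 \<pi> \<Longrightarrow> v \<in> L2 \<pi> \<Longrightarrow> (\<lambda>x. (semigroup K t u x - u x) / t - v x) \<in> L2 \<pi>"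
  by (intro L2_diff L2_divide semigroup_L2)

lemma generator_L2: "generator \<pi> K \<subseteq> L2 \<pi> \<times> L2 \<pi>"
  by (auto simp: generator_def)

lemma generator_lincomb:
  assumes "(u, v) \<in> generator \<pi> K" "(u', v') \<in> generator \<pi> K"
  shows "(\<lambda>x. a * u x + b * u' x, \<lambda>x. a * v x + b * v' x) \<in> generator \<pi> K"
proof -
  have L: "u \<in> L2 \<pi>" "v \<in> L2 \<pi>" "u' \<in> L2 \<pi>" "v' \<in> L2 \<pi>"
    using assms by (auto simp: generator_def)
  define D where "D t u v x = (semigroup K t u x - u x) / t - v x" for t u v x
  have lim: "((\<lambda>t. \<bar>a\<bar> * l2norm \<pi> (D t u v) + \<bar>b\<bar> * l2norm \<pi> (D t u' v')) \<longlongrightarrow> 0) (at_right 0)"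
  proof -
    have "((\<lambda>t. l2norm \<pi> (D t u v)) \<longlongrightarrow> 0) (at_right 0)" "((\<lambda>t. l2norm \<pi> (D t u' v')) \<longlongrightarrow> 0) (at_right 0)"
      using assms by (auto simp: generator_def D_def[abs_def])
    then have "((\<lambda>t. \<bar>a\<bar> * l2norm \<pi> (D t u v) + \<bar>b\<bar> * l2norm \<pi> (D t u' v')) \<longlongrightarrow> \<bar>a\<bar> * 0 + \<bar>b\<bar> * 0) (at_right 0)"
      by (intro tendsto_intros)
    then show ?thesis by simp
  qed
  have le: "l2norm \<pi> (D t (\<lambda>x. a * u x + b * u' x) (\<lambda>x. a * v x + b * v' x)) \<le>
      \<bar>a\<bar> * l2norm \<pi> (D t u v) + \<bar>b\<bar> * l2norm \<pi> (D t u' v')" if "0 < t" for t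
  proof -
    have DL: "D t f g \<in> L2 \<pi>" if "f \<in> L2 \<pi>" "g \<in> L2 \<pi>" for f g
      unfolding D_def[abs_def] using that \<open>0 < t\<close> by (intro difference_quotient_L2) auto
    have "l2norm \<pi> (D t (\<lambda>x. a * u x + b * u' x) (\<lambda>x. a * v x + b * v' x)) =
        l2norm \<pi> (\<lambda>x. a * D t u v x + b * D t u' v' x)"
    proof (rule l2norm_cong_AE)
      show "AE x in \<pi>. D t (\<lambda>x. a * u x + b * u' x) (\<lambda>x. a * v x + b * v' x) x =
          a * D t u v x + b * D t u' v' x"
        using semigroup_lincomb_AE[OF less_imp_le[OF that] L(1,3), of a b]
      proof eventually_elim
        case (elim x)
        show ?case unfolding D_def elim
          by (simp add: add_divide_distrib diff_divide_distrib algebra_simps)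
      qed
    qed (intro L2_measurable L2_lincomb DL L)+
    also have "\<dots> \<le> \<bar>a\<bar> * l2norm \<pi> (D t u v) + \<bar>b\<bar> * l2norm \<pi> (D t u' v')"
      by (intro l2norm_lincomb_le DL L)
    finally show ?thesis .
  qed
  have "((\<lambda>t. l2norm \<pi> (D t (\<lambda>x. a * u x + b * u' x) (\<lambda>x. a * v x + b * v' x))) \<longlongrightarrow> 0) (at_right 0)"
  proof (rule tendsto_sandwich[OF _ _ tendsto_const lim])
    show "\<forall>\<^sub>F t in at_right 0. l2norm \<pi> (D t (\<lambda>x. a * u x + b * u' x) (\<lambda>x. a * v x + b * v' x)) \<le>
        \<bar>a\<bar> * l2norm \<pi> (D t u v) + \<bar>b\<bar> * l2norm \<pi> (D t u' v')"
      using eventually_at_right_less by eventually_elim (rule le)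
  qed (simp add: l2norm_nonneg)
  then show ?thesis
    using L2_lincomb[OF L(1,3)] L2_lincomb[OF L(2,4)] unfolding generator_def D_def[abs_def] by blast
qed

text \<open>Contraction makes \<open><u, P_t u> - <u, u>\<close> nonpositive, where
  \<open>P_t\<close> is the semigroup. The difference quotient misses \<open>v\<close> by
  \<open>D t\<close>, whose contribution vanishes in the limit by Cauchy-Schwarz.\<close>

lemma generator_dissipative:
  assumes "(u, v) \<in> generator \<pi> K"
  shows "ip \<pi> u v \<le> 0"
proof -
  have L: "u \<in> L2 \<pi>" "v \<in> L2 \<pi>" using assms by (auto simp: generator_def)
  define D where "D t x = (semigroup K t u x - u x) / t - v x" for t x
  have "((\<lambda>t. l2norm \<pi> (D t)) \<longlongrightarrow> 0) (at_right 0)"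
    using assms by (auto simp: generator_def D_def[abs_def])
  then have lim: "((\<lambda>t. l2norm \<pi> u * l2norm \<pi> (D t)) \<longlongrightarrow> 0) (at_right 0)"
    using tendsto_mult_right_zero by blast
  have le: "ip \<pi> u v \<le> l2norm \<pi> u * l2norm \<pi> (D t)" if "0 < t" for t
  proof -
    have P: "semigroup K t u \<in> L2 \<pi>" using semigroup_L2 that L by simp
    have DL: "D t \<in> L2 \<pi>"
      unfolding D_def[abs_def] using that L by (intro difference_quotient_L2) auto
    have "v = (\<lambda>x. 1 * ((1 / t) * semigroup K t u x + (- 1 / t) * u x) + (-1) * D t x)"
      by (simp add: D_def diff_divide_distrib)
    then have "ip \<pi> u v = ip \<pi> u (\<lambda>x. 1 * ((1 / t) * semigroup K t u x + (- 1 / t) * u x) + (-1) * D t x)"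
      by simp
    also have "\<dots> = ip \<pi> u (\<lambda>x. (1 / t) * semigroup K t u x + (- 1 / t) * u x) - ip \<pi> u (D t)"
      by (subst ip_lincomb_right[OF L2_lincomb[OF P L(1)] DL L(1)]) simp
    also have "\<dots> = (ip \<pi> u (semigroup K t u) - ip \<pi> u u) / t - ip \<pi> u (D t)"
      by (subst ip_lincomb_right[OF P L(1) L(1)]) (simp add: diff_divide_distrib)
    also have "\<dots> \<le> \<bar>ip \<pi> u (D t)\<bar>"
    proof -
      have "(ip \<pi> u (semigroup K t u) - ip \<pi> u u) / t \<le> 0"
        using semigroup_ip_le[of t u] that L by (simp add: divide_le_0_iff)
      then show ?thesis by linarith
    qed
    also have "\<dots> \<le> l2norm \<pi> u * l2norm \<pi> (D t)"
      using ip_le_l2norm[OF L(1) DL] by simp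
    finally show ?thesis .
  qed
  have "\<forall>\<^sub>F t in at_right 0. ip \<pi> u v \<le> l2norm \<pi> u * l2norm \<pi> (D t)"
    using eventually_at_right_less by eventually_elim (rule le)
  then show ?thesis by (intro tendsto_lowerbound[OF lim]) auto
qed

lemma generator_one:
  assumes v: "v \<in> borel_measurable borel" "AE x in \<pi>. v x = 0"
  shows "(\<lambda>_. 1, v) \<in> generator \<pi> K"
proof -
  have v2: "v \<in> L2 \<pi>"
  proof (rule L2_cong_AE)
    show "(\<lambda>_. 0) \<in> L2 \<pi>" by (simp add: L2_def)
    show "AE x in \<pi>. 0 = v x" using v(2) by eventually_elim simp
    show "v \<in> borel_measurable \<pi>" using v(1) by simp
  qed
  have null: "l2norm \<pi> (\<lambda>x. (semigroup K t (\<lambda>_. 1) x - 1) / t - v x) = 0"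
    if "0 < t" for t
  proof -
    interpret kt: invariant_kernel \<pi> "K t" using that by (intro invariant_kernel_K) simp
    have "semigroup K t (\<lambda>_. 1) x = 1" for x
      using prob_space.prob_space[OF kt.prob_space_k, of x] by (simp add: semigroup_def)
    then have "l2norm \<pi> (\<lambda>x. (semigroup K t (\<lambda>_. 1) x - 1) / t - v x) = l2norm \<pi> (\<lambda>x. - v x)"
      by simp
    also have "\<dots> = l2norm \<pi> (\<lambda>_. 0)"
      using v by (intro l2norm_cong_AE) auto
    finally show ?thesis by (simp add: l2norm_def ip_def)
  qed
  have "\<forall>\<^sub>F t in at_right 0. l2norm \<pi> (\<lambda>x. (semigroup K t (\<lambda>_. 1) x - 1) / t - v x) = 0"
    using eventually_at_right_less by eventually_elim (rule null)
  then have "((\<lambda>t. l2norm \<pi> (\<lambda>x. (semigroup K t (\<lambda>_. 1) x - 1) / t - v x)) \<longlongrightarrow> 0) (at_right 0)"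
    by (rule tendsto_eventually)
  moreover have "(\<lambda>_. 1) \<in> L2 \<pi>" by (simp add: L2_def)
  ultimately show ?thesis unfolding generator_def using v2 by blast
qed

end

section \<open>Time averages and the resolvent\<close>

definition exp_measure :: "real \<Rightarrow> real measure" where
  "exp_measure r = density lborel (\<lambda>s. ennreal (exponential_density r s))"

lemma sets_exp_measure [simp, measurable_cong]: "sets (exp_measure r) = sets borel"
  and space_exp_measure [simp]: "space (exp_measure r) = UNIV"
  by (simp_all add: exp_measure_def)

lemma prob_space_exp_measure: "0 < r \<Longrightarrow> prob_space (exp_measure r)"
  unfolding exp_measure_def by (rule prob_space_exponential_density)

lemma nn_integral_exp_measure:
  "g \<in> borel_measurable borel \<Longrightarrow>
    (\<integral>\<^sup>+s. g s \<partial>exp_measure r) = (\<integral>\<^sup>+s. ennreal (exponential_density r s) * g s \<partial>lborel)"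
  unfolding exp_measure_def by (subst nn_integral_density) auto

text \<open>Split at time \<open>h\<close>. Beyond \<open>h\<close> the density equals
  \<open>exp (- (r * h))\<close> times the density shifted by \<open>h\<close>; before
  \<open>h\<close> the shifted density vanishes.\<close>

lemma exp_measure_memoryless_nn_integral:
  assumes r: "0 < r" and h: "0 \<le> h" and g [measurable]: "g \<in> borel_measurable borel"
  shows "(\<integral>\<^sup>+s. g s \<partial>exp_measure r) = (\<integral>\<^sup>+s. g s * indicator {0..<h} s \<partial>exp_measure r) +
    ennreal (exp (- (r * h))) * (\<integral>\<^sup>+s. g (h + s) \<partial>exp_measure r)"
proof -
  let ?d = "exponential_density r"
  have split: "ennreal (?d s) * g s = ennreal (?d s) * (g s * indicator {0..<h} s) +
      ennreal (exp (- (r * h))) * (ennreal (?d (s - h)) * g s)" for s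
  proof -
    consider "s < 0" | "0 \<le> s" "s < h" | "h \<le> s" by linarith
    then show ?thesis
    proof cases
      case 3
      have "?d s = exp (- (r * h)) * ?d (s - h)"
        using 3 h by (simp add: exponential_density_def algebra_simps flip: exp_add)
      then show ?thesis
        using 3 r by (simp add: ennreal_mult exponential_density_nonneg mult.assoc)
    qed (use h in \<open>simp_all add: exponential_density_def\<close>)
  qed
  have "(\<integral>\<^sup>+s. g s \<partial>exp_measure r) = (\<integral>\<^sup>+s. ennreal (?d s) * (g s * indicator {0..<h} s) \<partial>lborel) +
      ennreal (exp (- (r * h))) * (\<integral>\<^sup>+s. ennreal (?d (s - h)) * g s \<partial>lborel)"
    unfolding nn_integral_exp_measure[OF g] split
    by (subst nn_integral_add) (auto simp: nn_integral_cmult)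
  also have "(\<integral>\<^sup>+s. ennreal (?d (s - h)) * g s \<partial>lborel) = (\<integral>\<^sup>+s. ennreal (?d s) * g (h + s) \<partial>lborel)"
    by (subst nn_integral_real_affine[where c = 1 and t = h]) auto
  finally show ?thesis
    by (simp add: nn_integral_exp_measure)
qed

text \<open>The memoryless identity for the constant 1 determines this mass.\<close>

lemma emeasure_exp_measure:
  assumes r: "0 < r" and h: "0 \<le> h"
  shows "emeasure (exp_measure r) {0..<h} = ennreal (1 - exp (- (r * h)))"
proof -
  interpret e: prob_space "exp_measure r" using r by (rule prob_space_exp_measure)
  have "1 = emeasure (exp_measure r) {0..<h} + ennreal (exp (- (r * h)))"
    using exp_measure_memoryless_nn_integral[OF r h, of "\<lambda>_. 1"] e.emeasure_space_1 by simp
  then have "ennreal 1 = ennreal (e.prob {0..<h} + exp (- (r * h)))"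
    by (simp add: e.emeasure_eq_measure)
  then have "1 = e.prob {0..<h} + exp (- (r * h))"
    by (subst (asm) ennreal_inj) auto
  then have "e.prob {0..<h} = 1 - exp (- (r * h))" by simp
  then show ?thesis by (simp add: e.emeasure_eq_measure)
qed

text \<open>Here \<open>uniform_measure\<close> is the exponential law conditioned on
  \<open>{0..<h}\<close>, not the Lebesgue-uniform law. Writing the early part as a mean over a
  probability measure makes it the value of a Markov kernel later on.\<close>

lemma exp_measure_memoryless_uniform:
  assumes r: "0 < r" and h: "0 < h" and g [measurable]: "g \<in> borel_measurable borel"
  shows "(\<integral>\<^sup>+s. g s \<partial>exp_measure r) =
    ennreal (1 - exp (- (r * h))) * (\<integral>\<^sup>+s. g s \<partial>uniform_measure (exp_measure r) {0..<h}) +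
    ennreal (exp (- (r * h))) * (\<integral>\<^sup>+s. g (h + s) \<partial>exp_measure r)"
proof -
  have "ennreal (1 - exp (- (r * h))) \<noteq> 0" using r h by simp
  moreover have "(\<integral>\<^sup>+s. g s \<partial>uniform_measure (exp_measure r) {0..<h}) =
      (\<integral>\<^sup>+s. g s * indicator {0..<h} s \<partial>exp_measure r) / ennreal (1 - exp (- (r * h)))"
    using r h by (subst nn_integral_uniform_measure) (auto simp: emeasure_exp_measure)
  ultimately have "ennreal (1 - exp (- (r * h))) * (\<integral>\<^sup>+s. g s \<partial>uniform_measure (exp_measure r) {0..<h}) =
      (\<integral>\<^sup>+s. g s * indicator {0..<h} s \<partial>exp_measure r)"
    by (simp only: ennreal_times_divide mult.commute[of "ennreal _"] ennreal_mult_divide_eq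
        ennreal_neq_top not_False_eq_True)
  then show ?thesis
    using exp_measure_memoryless_nn_integral[OF r less_imp_le[OF h] g] by simp
qed

lemma prob_space_uniform_exp_measure:
  "0 < r \<Longrightarrow> 0 < h \<Longrightarrow> prob_space (uniform_measure (exp_measure r) {0..<h})"
  by (rule prob_space_uniform_measure) (auto simp: emeasure_exp_measure)

section \<open>Averages of the semigroup over a random time\<close>

context markov_semigroup
begin

text \<open>Law of the process started at \<open>x\<close> and observed at an independent time with
  law \<open>\<nu>\<close>. The exponential law gives the normalised resolvent kernel; the same law
  conditioned on \<open>{0..<h}\<close> gives a short-time mean.\<close>

definition avg :: "real measure \<Rightarrow> 'a \<Rightarrow> 'a measure" where
  "avg \<nu> x = \<nu> \<bind> (\<lambda>s. K (max 0 s) x)"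

text \<open>Each \<open>K s\<close> preserves \<open>\<pi>\<close>, hence so does the mixture, by
  exchanging the integrals over \<open>\<pi>\<close> and \<open>\<nu>\<close>. The exchange rests on
  joint measurability in time and space.\<close>

lemma
  assumes "prob_space \<nu>" and [simp, measurable_cong]: "sets \<nu> = sets borel"
  shows nn_integral_avg: "f \<in> borel_measurable borel \<Longrightarrow>
      (\<integral>\<^sup>+y. f y \<partial>avg \<nu> x) = (\<integral>\<^sup>+s. \<integral>\<^sup>+y. f y \<partial>K (max 0 s) x \<partial>\<nu>)"
    and invariant_kernel_avg: "invariant_kernel \<pi> (avg \<nu>)"
proof -
  interpret \<nu>: prob_space \<nu> by fact
  have K1: "(\<lambda>s. K (max 0 s) x) \<in> \<nu> \<rightarrow>\<^sub>M subprob_algebra borel" for x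
    by (rule measurable_prob_algebraD) measurable
  show nn: "(\<integral>\<^sup>+y. f y \<partial>avg \<nu> x) = (\<integral>\<^sup>+s. \<integral>\<^sup>+y. f y \<partial>K (max 0 s) x \<partial>\<nu>)"
    if "f \<in> borel_measurable borel" for f x
    unfolding avg_def by (rule nn_integral_bind[OF that K1])
  have nu: "\<nu> \<in> space (prob_algebra borel)"
    using \<nu>.prob_space_axioms by (simp add: space_prob_algebra)
  have avg: "avg \<nu> \<in> borel \<rightarrow>\<^sub>M prob_algebra borel"
  proof -
    have "(\<lambda>x. \<nu> \<bind> (\<lambda>s. K (max 0 s) x)) \<in> borel \<rightarrow>\<^sub>M prob_algebra borel"
      by (rule measurable_bind_prob_space2[where N = borel])
         (use nu in \<open>simp_all add: split_beta'\<close>)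
    then show ?thesis by (simp add: avg_def[abs_def])
  qed
  have avg': "avg \<nu> \<in> \<pi> \<rightarrow>\<^sub>M subprob_algebra borel"
    using measurable_prob_algebraD[OF avg] unfolding measurable_cong_sets[OF sets_pi refl] .
  have "\<pi> \<bind> avg \<nu> = \<pi>"
  proof (rule measure_eqI)
    show s: "sets (\<pi> \<bind> avg \<nu>) = sets \<pi>"
      using sets_bind[of \<pi> "avg \<nu>" borel] subprob_measurableD(2)[OF avg'] by simp
    fix B assume "B \<in> sets (\<pi> \<bind> avg \<nu>)"
    then have B [measurable]: "B \<in> sets borel" using s by simp
    interpret pair_sigma_finite \<pi> \<nu> ..
    have meas: "(\<lambda>(x, s). emeasure (K (max 0 s) x) B) \<in> borel_measurable (\<pi> \<Otimes>\<^sub>M \<nu>)"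
      unfolding split_beta'
      by (rule measurable_compose[OF _ measurable_emeasure_subprob_algebra[OF B]],
          rule measurable_prob_algebraD) measurable
    have "emeasure (\<pi> \<bind> avg \<nu>) B = (\<integral>\<^sup>+x. emeasure (avg \<nu> x) B \<partial>\<pi>)"
      by (rule emeasure_bind[OF _ avg' B]) simp
    also have "\<dots> = (\<integral>\<^sup>+x. \<integral>\<^sup>+s. emeasure (K (max 0 s) x) B \<partial>\<nu> \<partial>\<pi>)"
      unfolding avg_def by (intro nn_integral_cong emeasure_bind[OF _ K1 B]) (simp add: \<nu>.not_empty)
    also have "\<dots> = (\<integral>\<^sup>+s. \<integral>\<^sup>+x. emeasure (K (max 0 s) x) B \<partial>\<pi> \<partial>\<nu>)"
      using Fubini'[OF meas] by simp
    also have "\<dots> = (\<integral>\<^sup>+s. emeasure \<pi> B \<partial>\<nu>)"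
    proof (rule nn_integral_cong)
      fix s
      interpret ks: invariant_kernel \<pi> "K (max 0 s)" by (rule invariant_kernel_K) simp
      show "(\<integral>\<^sup>+x. emeasure (K (max 0 s) x) B \<partial>\<pi>) = emeasure \<pi> B"
        using ks.nn_integral_k[of "indicator B"] by simp
    qed
    finally show "emeasure (\<pi> \<bind> avg \<nu>) B = emeasure \<pi> B"
      by (simp add: \<nu>.emeasure_space_1)
  qed
  then show "invariant_kernel \<pi> (avg \<nu>)"
    using avg by unfold_locales simp_all
qed

text \<open>Where the integral diverges both sides are 0. This form transfers joint measurability in
  time and space from nonnegative integrals to the semigroup.\<close>

lemma semigroup_eq_enn2real:
  assumes "f \<in> borel_measurable borel" "\<And>x. 0 \<le> f x" "0 \<le> t"
  shows "semigroup K t f x = enn2real (\<integral>\<^sup>+y. ennreal (f y) \<partial>K t x)"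
proof -
  interpret kt: invariant_kernel \<pi> "K t" using assms(3) by (rule invariant_kernel_K)
  show ?thesis unfolding semigroup_def using assms by (intro integral_eq_nn_integral) auto
qed

text \<open>Jensen in \<open>\<nu>\<close> for almost every \<open>x\<close>, then an exchange of
  the integrals over \<open>\<pi>\<close> and \<open>\<nu>\<close>. Nonnegativity of
  \<open>f\<close> lets the average be disintegrated through nonnegative integrals.\<close>

lemma avg_diff_le:
  assumes "prob_space \<nu>" and sets_nu [simp, measurable_cong]: "sets \<nu> = sets borel"
    and f: "f \<in> L2 \<pi>" and f0: "\<And>x. 0 \<le> f x"
  shows "ennreal ((l2norm \<pi> (\<lambda>x. (\<integral>y. f y \<partial>avg \<nu> x) - f x))\<^sup>2) \<le>
    (\<integral>\<^sup>+s. ennreal ((l2norm \<pi> (\<lambda>x. semigroup K (max 0 s) f x - f x))\<^sup>2) \<partial>\<nu>)"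
proof -
  interpret \<nu>: prob_space \<nu> by fact
  interpret R: invariant_kernel \<pi> "avg \<nu>" by (rule invariant_kernel_avg) fact+
  interpret pair_sigma_finite \<pi> \<nu> ..
  have f_meas [measurable]: "f \<in> borel_measurable borel" using L2_measurable[OF f] by simp
  have space_nu [simp]: "space \<nu> = UNIV" using sets_eq_imp_space_eq[OF sets_nu] by simp
  define G where "G s x = (\<integral>\<^sup>+y. ennreal (f y) \<partial>K (max 0 s) x)" for s x
  have G_meas: "(\<lambda>p. G (snd p) (fst p)) \<in> borel_measurable (\<pi> \<Otimes>\<^sub>M \<nu>)"
    unfolding G_def
    by (rule measurable_compose[OF _ nn_integral_measurable_subprob_algebra[of _ borel]],
        rule measurable_prob_algebraD) measurable
  have G1 [measurable]: "(\<lambda>s. G s x) \<in> borel_measurable \<nu>" for x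
    using measurable_compose[OF measurable_Pair1' G_meas, of x] by simp
  have P: "semigroup K (max 0 s) f x = enn2real (G s x)" for s x
    unfolding G_def by (rule semigroup_eq_enn2real) (simp_all add: f0)
  have P1 [measurable]: "(\<lambda>s. semigroup K (max 0 s) f x) \<in> borel_measurable \<nu>" for x
    unfolding P by measurable
  have P_meas: "(\<lambda>(x, s). ennreal ((semigroup K (max 0 s) f x - f x)\<^sup>2)) \<in> borel_measurable (\<pi> \<Otimes>\<^sub>M \<nu>)"
    unfolding P split_beta' using G_meas by measurable
  have "AE x in \<pi>. ennreal (((\<integral>y. f y \<partial>avg \<nu> x) - f x)\<^sup>2) \<le>
      (\<integral>\<^sup>+s. ennreal ((semigroup K (max 0 s) f x - f x)\<^sup>2) \<partial>\<nu>)"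
    using R.AE_integrable_k[OF f]
  proof eventually_elim
    case (elim x)
    have eq: "(\<integral>\<^sup>+y. ennreal (f y) \<partial>avg \<nu> x) = (\<integral>\<^sup>+s. G s x \<partial>\<nu>)"
      unfolding G_def by (rule nn_integral_avg) (use assms in auto)
    have fin: "(\<integral>\<^sup>+s. G s x \<partial>\<nu>) < \<infinity>"
      using elim f0 unfolding eq[symmetric] by (simp add: integrable_iff_bounded)
    then have AEfin: "AE s in \<nu>. G s x \<noteq> \<infinity>"
      by (intro nn_integral_noteq_infinite) auto
    \<comment> \<open>\<open>G s x\<close> and the semigroup differ only where \<open>G s x\<close>
      is infinite and the real integral defaults to 0; finiteness of the total makes such times
      negligible.\<close>
    have Geq: "(\<integral>\<^sup>+s. G s x \<partial>\<nu>) = (\<integral>\<^sup>+s. ennreal (semigroup K (max 0 s) f x) \<partial>\<nu>)"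
      using AEfin by (intro nn_integral_cong_AE) (auto simp: P less_top)
    have int: "integrable \<nu> (\<lambda>s. semigroup K (max 0 s) f x)"
      using fin unfolding Geq by (intro integrableI_nonneg) (auto simp: P)
    have "(\<integral>y. f y \<partial>avg \<nu> x) = enn2real (\<integral>\<^sup>+s. G s x \<partial>\<nu>)"
      unfolding eq[symmetric] using f0 by (intro integral_eq_nn_integral) auto
    also have "\<dots> = (\<integral>s. semigroup K (max 0 s) f x \<partial>\<nu>)"
      unfolding Geq by (intro integral_eq_nn_integral[symmetric]) (auto simp: P)
    finally have "(\<integral>y. f y \<partial>avg \<nu> x) - f x = (\<integral>s. semigroup K (max 0 s) f x - f x \<partial>\<nu>)"
      using int \<nu>.prob_space by simp
    then show ?case
      using \<nu>.integral_sq_le_nn_integral[of "\<lambda>s. semigroup K (max 0 s) f x - f x"] by simp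
  qed
  then have "(\<integral>\<^sup>+x. ennreal (((\<integral>y. f y \<partial>avg \<nu> x) - f x)\<^sup>2) \<partial>\<pi>) \<le>
      (\<integral>\<^sup>+x. \<integral>\<^sup>+s. ennreal ((semigroup K (max 0 s) f x - f x)\<^sup>2) \<partial>\<nu> \<partial>\<pi>)"
    by (rule nn_integral_mono_AE)
  also have "\<dots> = (\<integral>\<^sup>+s. \<integral>\<^sup>+x. ennreal ((semigroup K (max 0 s) f x - f x)\<^sup>2) \<partial>\<pi> \<partial>\<nu>)"
    using Fubini'[OF P_meas] by simp
  also have "\<dots> = (\<integral>\<^sup>+s. ennreal ((l2norm \<pi> (\<lambda>x. semigroup K (max 0 s) f x - f x))\<^sup>2) \<partial>\<nu>)"
    by (intro nn_integral_cong nn_integral_sq_eq L2_diff semigroup_L2 f) simp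
  finally show ?thesis
    using nn_integral_sq_eq[OF L2_diff[OF R.op_L2[OF f] f]] by simp
qed

end

section \<open>The resolvent maps into the domain and approximates the identity\<close>

locale continuous_markov_semigroup = markov_semigroup +
  assumes strongly_continuous: "strongly_continuous \<pi> K"
begin

text \<open>This is \<open>r (r - L)\<inverse>\<close>, normalised to be a Markov operator.\<close>

definition resolvent :: "real \<Rightarrow> ('a \<Rightarrow> real) \<Rightarrow> 'a \<Rightarrow> real" where
  "resolvent r f x = (\<integral>y. f y \<partial>avg (exp_measure r) x)"

text \<open>Adds the time 0, which the one-sided limit omits but the interval \<open>{0..<h}\<close>
  contains.\<close>

lemma semigroup_near_zero:
  assumes f: "f \<in> L2 \<pi>" and e: "0 < e"
  obtains \<delta> where "0 < \<delta>" "\<And>s. 0 \<le> s \<Longrightarrow> s < \<delta> \<Longrightarrow> l2norm \<pi> (\<lambda>x. semigroup K s f x - f x) \<le> e"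
proof -
  have [measurable]: "f \<in> borel_measurable borel" using L2_measurable[OF f] by simp
  have "((\<lambda>t. l2norm \<pi> (\<lambda>x. semigroup K t f x - f x)) \<longlongrightarrow> 0) (at_right 0)"
    using strongly_continuous f by (simp add: strongly_continuous_def)
  then have "\<forall>\<^sub>F t in at_right 0. l2norm \<pi> (\<lambda>x. semigroup K t f x - f x) < e"
    using e by (rule order_tendstoD)
  then obtain \<delta> where \<delta>: "0 < \<delta>" "\<And>s. 0 < s \<Longrightarrow> s < \<delta> \<Longrightarrow> l2norm \<pi> (\<lambda>x. semigroup K s f x - f x) < e"
    by (auto simp: eventually_at_right_field)
  have "semigroup K 0 f x = f x" for x
    using trans by (simp add: transition_function_def semigroup_def integral_return)
  then have "l2norm \<pi> (\<lambda>x. semigroup K 0 f x - f x) \<le> e"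
    using e by (simp add: l2norm_def ip_def)
  with \<delta> show thesis by (intro that[of \<delta>]) (auto simp: le_less)
qed

lemma
  assumes r: "0 < r"
  shows resolvent_L2: "f \<in> L2 \<pi> \<Longrightarrow> resolvent r f \<in> L2 \<pi>"
    and resolvent_nonneg: "(\<And>x. 0 \<le> f x) \<Longrightarrow> 0 \<le> resolvent r f x"
proof -
  interpret R: invariant_kernel \<pi> "avg (exp_measure r)"
    by (intro invariant_kernel_avg prob_space_exp_measure r) simp
  show "f \<in> L2 \<pi> \<Longrightarrow> resolvent r f \<in> L2 \<pi>"
    using R.op_L2[of f] by (simp add: resolvent_def[abs_def])
  show "(\<And>x. 0 \<le> f x) \<Longrightarrow> 0 \<le> resolvent r f x"
    by (simp add: resolvent_def)
qed

text \<open>Condition on whether the exponential time exceeds \<open>h\<close>. If it does, the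
  remaining time is again exponential and the semigroup law restarts the process at time
  \<open>h\<close>. In operator form \<open>R = (1 - c) Q + c K_h R\<close> with
  \<open>c = exp (- (r * h))\<close>.\<close>

lemma nn_integral_avg_exp_measure:
  assumes r: "0 < r" and h: "0 < h" and f [measurable]: "f \<in> borel_measurable borel"
  shows "(\<integral>\<^sup>+y. f y \<partial>avg (exp_measure r) x) =
    ennreal (1 - exp (- (r * h))) * (\<integral>\<^sup>+y. f y \<partial>avg (uniform_measure (exp_measure r) {0..<h}) x) +
    ennreal (exp (- (r * h))) * (\<integral>\<^sup>+y. \<integral>\<^sup>+z. f z \<partial>avg (exp_measure r) y \<partial>K h x)"
proof -
  interpret e: prob_space "exp_measure r" using r by (rule prob_space_exp_measure)
  interpret kh: invariant_kernel \<pi> "K h" using h by (intro invariant_kernel_K) simp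
  interpret khx: prob_space "K h x" by (rule kh.prob_space_k)
  interpret pair_sigma_finite "K h x" "exp_measure r" ..
  define G where "G s x = (\<integral>\<^sup>+y. f y \<partial>K (max 0 s) x)" for s x
  have G_meas: "(\<lambda>(y, s). G s y) \<in> borel_measurable (K h x \<Otimes>\<^sub>M exp_measure r)"
    unfolding G_def split_beta'
    by (rule measurable_compose[OF _ nn_integral_measurable_subprob_algebra[of _ borel]],
        rule measurable_prob_algebraD) measurable
  have G1 [measurable]: "(\<lambda>s. G s x) \<in> borel_measurable borel" for x
    unfolding G_def
    by (rule measurable_compose[OF _ nn_integral_measurable_subprob_algebra[of _ borel]],
        rule measurable_prob_algebraD) measurable
  have semi: "G (h + s) x = (\<integral>\<^sup>+y. G s y \<partial>K h x)" if "0 \<le> s" for s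
  proof -
    interpret ks: invariant_kernel \<pi> "K s" using that by (rule invariant_kernel_K)
    have "K (h + s) x = K h x \<bind> K s"
      using trans h that by (simp add: transition_function_def)
    moreover have "K s \<in> K h x \<rightarrow>\<^sub>M subprob_algebra borel"
      using ks.k_subprob unfolding measurable_cong_sets[OF kh.sets_k refl] .
    ultimately show ?thesis
      using h that by (simp add: G_def nn_integral_bind[OF f])
  qed
  \<comment> \<open>The semigroup law holds only at nonnegative times; the exponential density
    vanishes at the others.\<close>
  have "AE s in exp_measure r. 0 \<le> s"
    unfolding exp_measure_def by (subst AE_density) (auto simp: exponential_density_def)
  then have "(\<integral>\<^sup>+s. G (h + s) x \<partial>exp_measure r) = (\<integral>\<^sup>+s. \<integral>\<^sup>+y. G s y \<partial>K h x \<partial>exp_measure r)"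
    by (intro nn_integral_cong_AE) (auto simp: semi)
  also have "\<dots> = (\<integral>\<^sup>+y. \<integral>\<^sup>+s. G s y \<partial>exp_measure r \<partial>K h x)"
    using Fubini'[OF G_meas] by simp
  finally have "(\<integral>\<^sup>+s. G (h + s) x \<partial>exp_measure r) = (\<integral>\<^sup>+y. \<integral>\<^sup>+s. G s y \<partial>exp_measure r \<partial>K h x)" .
  moreover have "(\<integral>\<^sup>+y. f y \<partial>avg \<nu> x) = (\<integral>\<^sup>+s. G s x \<partial>\<nu>)"
    if "prob_space \<nu>" "sets \<nu> = sets borel" for \<nu> x
    using nn_integral_avg[OF that f] by (simp add: G_def)
  ultimately show ?thesis
    using exp_measure_memoryless_uniform[OF r h G1, of x] prob_space_uniform_exp_measure[OF r h]
      e.prob_space_axioms by simp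
qed

text \<open>The decomposition \<open>R f = (1 - c) Q f + c K_h R f\<close> solved for
  \<open>K_h R f\<close>; the factor is \<open>1 / c - 1\<close>. Infinite values must be excluded
  before solving, hence the null set.\<close>

lemma semigroup_resolvent_AE:
  assumes r: "0 < r" and h: "0 < h" and f: "f \<in> L2 \<pi>" and f0: "\<And>x. 0 \<le> f x"
  shows "AE x in \<pi>. semigroup K h (resolvent r f) x - resolvent r f x = (exp (r * h) - 1) *
    (resolvent r f x - (\<integral>y. f y \<partial>avg (uniform_measure (exp_measure r) {0..<h}) x))"
proof -
  interpret R: invariant_kernel \<pi> "avg (exp_measure r)"
    by (intro invariant_kernel_avg prob_space_exp_measure r) simp
  interpret Q: invariant_kernel \<pi> "avg (uniform_measure (exp_measure r) {0..<h})"
    by (intro invariant_kernel_avg prob_space_uniform_exp_measure r h) simp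
  interpret kh: invariant_kernel \<pi> "K h" using h by (intro invariant_kernel_K) simp
  have [measurable]: "f \<in> borel_measurable borel" using L2_measurable[OF f] by simp
  have u: "resolvent r f \<in> L2 \<pi>" using resolvent_L2[OF r f] .
  have fin: "AE x in \<pi>. (\<integral>\<^sup>+y. ennreal (f y) \<partial>avg (exp_measure r) x) = ennreal (resolvent r f x)"
    using R.AE_integrable_k[OF f]
    by eventually_elim (simp add: nn_integral_eq_integral f0 resolvent_def)
  \<comment> \<open>Finiteness of the averaged integral is needed at \<open>x\<close> and also at
    almost every point reached from \<open>x\<close> under \<open>K h\<close>; invariance supplies
    the latter.\<close>
  show ?thesis
    using fin kh.AE_k[OF fin] Q.AE_integrable_k[OF f] kh.AE_integrable_k[OF u]
  proof eventually_elim
    case (elim x)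
    let ?c = "exp (- (r * h))"
    let ?q = "\<integral>y. f y \<partial>avg (uniform_measure (exp_measure r) {0..<h}) x"
    have q0: "0 \<le> ?q" and p0: "0 \<le> semigroup K h (resolvent r f) x" and u0: "0 \<le> resolvent r f x"
      by (simp_all add: f0 semigroup_def resolvent_nonneg r)
    have c1: "0 \<le> 1 - ?c" using r h by simp
    have "(\<integral>\<^sup>+y. \<integral>\<^sup>+z. f z \<partial>avg (exp_measure r) y \<partial>K h x) = (\<integral>\<^sup>+y. ennreal (resolvent r f y) \<partial>K h x)"
      by (rule nn_integral_cong_AE) (use elim(2) in simp)
    also have "\<dots> = ennreal (semigroup K h (resolvent r f) x)"
      unfolding semigroup_def using elim(4) by (simp add: nn_integral_eq_integral resolvent_nonneg f0 r)
    finally have "ennreal (resolvent r f x) =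
        ennreal (1 - ?c) * ennreal ?q + ennreal ?c * ennreal (semigroup K h (resolvent r f) x)"
      using nn_integral_avg_exp_measure[OF r h, of f x] elim(1,3)
      by (simp add: nn_integral_eq_integral f0)
    also have "\<dots> = ennreal ((1 - ?c) * ?q + ?c * semigroup K h (resolvent r f) x)"
      unfolding ennreal_mult[OF c1 q0, symmetric] ennreal_mult[OF exp_ge_zero p0, symmetric]
      by (rule ennreal_plus[symmetric]) (intro mult_nonneg_nonneg c1 q0 p0 exp_ge_zero)+
    finally have "resolvent r f x = (1 - ?c) * ?q + ?c * semigroup K h (resolvent r f) x"
      using q0 p0 c1 u0 by (subst (asm) ennreal_inj) auto
    then have "exp (r * h) * resolvent r f x =
        exp (r * h) * ((1 - ?c) * ?q + ?c * semigroup K h (resolvent r f) x)"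
      by simp
    also have "\<dots> = (exp (r * h) - exp (r * h) * ?c) * ?q + exp (r * h) * ?c * semigroup K h (resolvent r f) x"
      by (simp add: algebra_simps)
    also have "exp (r * h) * ?c = 1" by (simp flip: exp_add)
    finally show ?case by (simp add: algebra_simps)
  qed
qed

text \<open>The difference quotient at \<open>h\<close> is exactly \<open>c h\<close> times
  \<open>resolvent r f - q h\<close>. As \<open>h\<close> tends to 0, \<open>c h\<close> tends to
  \<open>r\<close>, the derivative of \<open>exp (r * h)\<close> at 0, and the short-time mean
  \<open>q h\<close> tends to \<open>f\<close> by strong continuity.\<close>

lemma resolvent_generator:
  assumes r: "0 < r" and f: "f \<in> L2 \<pi>" and f0: "\<And>x. 0 \<le> f x"
  shows "(resolvent r f, \<lambda>x. r * (resolvent r f x - f x)) \<in> generator \<pi> K"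
proof -
  let ?u = "resolvent r f"
  define q where "q h x = (\<integral>y. f y \<partial>avg (uniform_measure (exp_measure r) {0..<h}) x)" for h x
  define c where "c h = (exp (r * h) - 1) / h" for h
  have u: "?u \<in> L2 \<pi>" using resolvent_L2[OF r f] .
  have q: "q h \<in> L2 \<pi>" if "0 < h" for h
  proof -
    interpret Q: invariant_kernel \<pi> "avg (uniform_measure (exp_measure r) {0..<h})"
      by (intro invariant_kernel_avg prob_space_uniform_exp_measure r that) simp
    show ?thesis using Q.op_L2[OF f] by (simp add: q_def[abs_def])
  qed
  have qlim: "((\<lambda>h. l2norm \<pi> (\<lambda>x. q h x - f x)) \<longlongrightarrow> 0) (at_right 0)"
  proof (rule order_tendstoI)
    fix e :: real assume "0 < e"
    then have e2: "0 < e / 2" by simp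
    obtain \<delta> where \<delta>: "0 < \<delta>" "\<And>s. 0 \<le> s \<Longrightarrow> s < \<delta> \<Longrightarrow> l2norm \<pi> (\<lambda>x. semigroup K s f x - f x) \<le> e / 2"
      by (rule semigroup_near_zero[OF f e2]) blast
    have "l2norm \<pi> (\<lambda>x. q h x - f x) < e" if h: "0 < h" "h < \<delta>" for h
    proof -
      let ?\<nu> = "uniform_measure (exp_measure r) {0..<h}"
      interpret \<nu>: prob_space ?\<nu> by (rule prob_space_uniform_exp_measure[OF r h(1)])
      have ae: "AE s in ?\<nu>. s \<in> {0..<h}"
        by (rule AE_uniform_measureI) auto
      have "ennreal ((l2norm \<pi> (\<lambda>x. q h x - f x))\<^sup>2) \<le>
          (\<integral>\<^sup>+s. ennreal ((l2norm \<pi> (\<lambda>x. semigroup K (max 0 s) f x - f x))\<^sup>2) \<partial>?\<nu>)"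
        unfolding q_def using \<nu>.prob_space_axioms f f0 by (intro avg_diff_le) simp_all
      also have "\<dots> \<le> (\<integral>\<^sup>+s. ennreal ((e / 2)\<^sup>2) \<partial>?\<nu>)"
      proof (rule nn_integral_mono_AE)
        show "AE s in ?\<nu>. ennreal ((l2norm \<pi> (\<lambda>x. semigroup K (max 0 s) f x - f x))\<^sup>2) \<le> ennreal ((e / 2)\<^sup>2)"
          using ae
        proof eventually_elim
          case (elim s)
          then have "l2norm \<pi> (\<lambda>x. semigroup K (max 0 s) f x - f x) \<le> e / 2"
            using h by (intro \<delta>) auto
          then show ?case by (intro ennreal_leI power_mono l2norm_nonneg)
        qed
      qed
      also have "\<dots> = ennreal ((e / 2)\<^sup>2)" using \<nu>.emeasure_space_1 by simp
      finally have "l2norm \<pi> (\<lambda>x. q h x - f x) \<le> e / 2"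
        using e2 by (simp add: power_mono_iff l2norm_nonneg del: power_divide)
      then show ?thesis using e2 by simp
    qed
    then show "\<forall>\<^sub>F h in at_right 0. l2norm \<pi> (\<lambda>x. q h x - f x) < e"
      using \<delta>(1) by (auto simp: eventually_at_right_field)
  next
    fix e :: real assume "e < 0"
    then have "e < l2norm \<pi> (\<lambda>x. q h x - f x)" for h
      using l2norm_nonneg[of \<pi>] by (rule less_le_trans)
    then show "\<forall>\<^sub>F h in at_right 0. e < l2norm \<pi> (\<lambda>x. q h x - f x)"
      by simp
  qed
  have clim: "(c \<longlongrightarrow> r) (at_right 0)"
  proof -
    have "((\<lambda>h. exp (r * h)) has_real_derivative r) (at 0)"
      by (auto intro!: derivative_eq_intros)
    then have "(c \<longlongrightarrow> r) (at 0)" by (simp add: DERIV_def c_def[abs_def])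
    then show ?thesis by (rule tendsto_mono[rotated]) (simp add: at_le)
  qed
  have lim: "((\<lambda>h. \<bar>c h - r\<bar> * l2norm \<pi> (\<lambda>x. ?u x - f x) + \<bar>- c h\<bar> * l2norm \<pi> (\<lambda>x. q h x - f x))
      \<longlongrightarrow> \<bar>r - r\<bar> * l2norm \<pi> (\<lambda>x. ?u x - f x) + \<bar>- r\<bar> * 0) (at_right 0)"
    by (intro tendsto_intros clim qlim)
  have le: "l2norm \<pi> (\<lambda>x. (semigroup K h ?u x - ?u x) / h - r * (?u x - f x)) \<le>
      \<bar>c h - r\<bar> * l2norm \<pi> (\<lambda>x. ?u x - f x) + \<bar>- c h\<bar> * l2norm \<pi> (\<lambda>x. q h x - f x)" if h: "0 < h" for h
  proof -
    \<comment> \<open>Regroups \<open>c (u - q) - r (u - f)\<close> as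
      \<open>(c - r) (u - f) - c (q - f)\<close>, two terms that vanish separately.\<close>
    have "l2norm \<pi> (\<lambda>x. (semigroup K h ?u x - ?u x) / h - r * (?u x - f x)) =
        l2norm \<pi> (\<lambda>x. (c h - r) * (?u x - f x) + (- c h) * (q h x - f x))"
    proof (rule l2norm_cong_AE)
      show "(\<lambda>x. (semigroup K h ?u x - ?u x) / h - r * (?u x - f x)) \<in> borel_measurable \<pi>"
        using h u f by (intro L2_measurable difference_quotient_L2 L2_cmult L2_diff) auto
      show "(\<lambda>x. (c h - r) * (?u x - f x) + (- c h) * (q h x - f x)) \<in> borel_measurable \<pi>"
        using u f q[OF h] by (intro L2_measurable L2_lincomb L2_diff)
      show "AE x in \<pi>. (semigroup K h ?u x - ?u x) / h - r * (?u x - f x) =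
          (c h - r) * (?u x - f x) + (- c h) * (q h x - f x)"
        using semigroup_resolvent_AE[OF r h f f0]
      proof eventually_elim
        case (elim x)
        have "(semigroup K h ?u x - ?u x) / h = c h * (?u x - q h x)"
          unfolding elim by (simp add: c_def q_def)
        then show ?case by (simp add: algebra_simps)
      qed
    qed
    also have "\<dots> \<le> \<bar>c h - r\<bar> * l2norm \<pi> (\<lambda>x. ?u x - f x) + \<bar>- c h\<bar> * l2norm \<pi> (\<lambda>x. q h x - f x)"
      using u f q[OF h] by (intro l2norm_lincomb_le L2_diff)
    finally show ?thesis .
  qed
  have "((\<lambda>h. l2norm \<pi> (\<lambda>x. (semigroup K h ?u x - ?u x) / h - r * (?u x - f x))) \<longlongrightarrow> 0) (at_right 0)"
  proof (rule tendsto_sandwich[OF _ _ tendsto_const])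
    show "\<forall>\<^sub>F h in at_right 0. l2norm \<pi> (\<lambda>x. (semigroup K h ?u x - ?u x) / h - r * (?u x - f x)) \<le>
        \<bar>c h - r\<bar> * l2norm \<pi> (\<lambda>x. ?u x - f x) + \<bar>- c h\<bar> * l2norm \<pi> (\<lambda>x. q h x - f x)"
      using eventually_at_right_less by eventually_elim (rule le)
    show "((\<lambda>h. \<bar>c h - r\<bar> * l2norm \<pi> (\<lambda>x. ?u x - f x) + \<bar>- c h\<bar> * l2norm \<pi> (\<lambda>x. q h x - f x))
      \<longlongrightarrow> 0) (at_right 0)" using lim by simp
  qed (simp add: l2norm_nonneg)
  then show ?thesis
    unfolding generator_def using u f by (intro CollectI case_prodI conjI L2_cmult L2_diff)
qed

text \<open>For large \<open>r\<close> the exponential time concentrates at 0. Before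
  \<open>\<delta>\<close> strong continuity controls the error; afterwards contraction bounds its
  square by \<open>C\<close>, with probability \<open>exp (- (r * \<delta>))\<close>.\<close>

lemma resolvent_approx:
  assumes f: "f \<in> L2 \<pi>" and f0: "\<And>x. 0 \<le> f x" and e: "0 < e"
  obtains r where "0 < r" "l2norm \<pi> (\<lambda>x. resolvent r f x - f x) \<le> e"
proof -
  have e2: "0 < e / 2" using e by simp
  obtain \<delta> where \<delta>: "0 < \<delta>" "\<And>s. 0 \<le> s \<Longrightarrow> s < \<delta> \<Longrightarrow> l2norm \<pi> (\<lambda>x. semigroup K s f x - f x) \<le> e / 2"
    by (rule semigroup_near_zero[OF f e2]) blast
  define C where "C = (2 * l2norm \<pi> f)\<^sup>2"
  \<comment> \<open>Makes \<open>C \<le> r * \<delta> * (e / 2)^2\<close>, so that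
    \<open>x \<le> exp x\<close> bounds the late contribution by \<open>(e / 2)^2\<close>. The
    summand 1 keeps \<open>r\<close> positive when \<open>C = 0\<close>.\<close>
  define r where "r = (C + 1) / (\<delta> * (e / 2)\<^sup>2)"
  have C0: "0 \<le> C" by (simp add: C_def)
  have r: "0 < r" using C0 \<delta> e unfolding r_def by (intro divide_pos_pos mult_pos_pos) auto
  interpret \<nu>: prob_space "exp_measure r" using r by (rule prob_space_exp_measure)
  have bound: "(l2norm \<pi> (\<lambda>x. semigroup K (max 0 s) f x - f x))\<^sup>2 \<le> C" for s
  proof -
    have P: "semigroup K (max 0 s) f \<in> L2 \<pi>" using f by (intro semigroup_L2) auto
    have "l2norm \<pi> (\<lambda>x. semigroup K (max 0 s) f x - f x) \<le> l2norm \<pi> (semigroup K (max 0 s) f) + l2norm \<pi> f"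
      using l2norm_lincomb_le[OF P f, of 1 "-1"] by simp
    also have "\<dots> \<le> 2 * l2norm \<pi> f"
      using semigroup_contraction[of "max 0 s" f] f by simp
    finally show ?thesis unfolding C_def by (intro power_mono l2norm_nonneg)
  qed
  have "ennreal ((l2norm \<pi> (\<lambda>x. resolvent r f x - f x))\<^sup>2) \<le>
      (\<integral>\<^sup>+s. ennreal ((l2norm \<pi> (\<lambda>x. semigroup K (max 0 s) f x - f x))\<^sup>2) \<partial>exp_measure r)"
    unfolding resolvent_def using \<nu>.prob_space_axioms f f0 by (intro avg_diff_le) simp_all
  also have "\<dots> \<le> (\<integral>\<^sup>+s. ennreal ((e / 2)\<^sup>2) + ennreal C * indicator (- {0..<\<delta>}) s \<partial>exp_measure r)"
  proof (rule nn_integral_mono_AE)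
    have "AE s in exp_measure r. 0 \<le> s"
      unfolding exp_measure_def by (subst AE_density) (auto simp: exponential_density_def)
    then show "AE s in exp_measure r. ennreal ((l2norm \<pi> (\<lambda>x. semigroup K (max 0 s) f x - f x))\<^sup>2) \<le>
        ennreal ((e / 2)\<^sup>2) + ennreal C * indicator (- {0..<\<delta>}) s"
    proof eventually_elim
      case (elim s)
      show ?case
      proof (cases "s < \<delta>")
        case True
        then have "(l2norm \<pi> (\<lambda>x. semigroup K (max 0 s) f x - f x))\<^sup>2 \<le> (e / 2)\<^sup>2"
          using elim by (intro power_mono l2norm_nonneg \<delta>) auto
        then show ?thesis using elim True by (simp del: power_divide add: ennreal_leI)
      next
        case False
        then show ?thesis using ennreal_leI[OF bound[of s]] by (simp add: add_increasing)
      qed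
    qed
  qed
  also have "\<dots> = ennreal ((e / 2)\<^sup>2) + ennreal C * emeasure (exp_measure r) (- {0..<\<delta>})"
    using \<nu>.emeasure_space_1 by (simp add: nn_integral_add nn_integral_cmult del: power_divide)
  also have "emeasure (exp_measure r) (- {0..<\<delta>}) = ennreal (exp (- (r * \<delta>)))"
  proof -
    have "\<nu>.prob {0..<\<delta>} = 1 - exp (- (r * \<delta>))"
      using emeasure_exp_measure[OF r, of \<delta>] \<delta>(1) r by (simp add: \<nu>.emeasure_eq_measure)
    then show ?thesis
      using \<nu>.prob_compl[of "{0..<\<delta>}"] by (simp add: \<nu>.emeasure_eq_measure Compl_eq_Diff_UNIV)
  qed
  also have "ennreal ((e / 2)\<^sup>2) + ennreal C * ennreal (exp (- (r * \<delta>))) = ennreal ((e / 2)\<^sup>2 + C * exp (- (r * \<delta>)))"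
    using C0 by (simp add: ennreal_mult ennreal_plus del: power_divide)
  finally have le: "(l2norm \<pi> (\<lambda>x. resolvent r f x - f x))\<^sup>2 \<le> (e / 2)\<^sup>2 + C * exp (- (r * \<delta>))"
    by (subst (asm) ennreal_le_iff) (use C0 in auto)
  have "C * exp (- (r * \<delta>)) \<le> (e / 2)\<^sup>2"
  proof -
    have "C \<le> r * \<delta> * (e / 2)\<^sup>2" using \<delta>(1) e by (simp add: r_def)
    also have "\<dots> \<le> exp (r * \<delta>) * (e / 2)\<^sup>2"
    proof (rule mult_right_mono)
      show "r * \<delta> \<le> exp (r * \<delta>)" using exp_ge_add_one_self[of "r * \<delta>"] by linarith
    qed simp
    finally show ?thesis by (simp add: exp_minus field_simps)
  qed
  moreover have "(e / 2)\<^sup>2 = e\<^sup>2 / 4" by (simp add: power_divide)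
  ultimately have "(l2norm \<pi> (\<lambda>x. resolvent r f x - f x))\<^sup>2 \<le> e\<^sup>2"
    using le zero_le_power2[of e] by linarith
  then have "l2norm \<pi> (\<lambda>x. resolvent r f x - f x) \<le> e"
    using e by (simp add: power_mono_iff l2norm_nonneg)
  with r show thesis by (rule that)
qed

end

section \<open>The Donsker--Varadhan functional\<close>

lemma dv_rate_ge:
  assumes "(u, v) \<in> L" "\<And>x. 0 < u x"
  shows "- eintegral \<mu> (\<lambda>x. v x / u x) \<le> dv_rate L \<mu>"
proof -
  have "(INF (u, v)\<in>{(u, v) \<in> L. \<forall>x. 0 < u x}. eintegral \<mu> (\<lambda>x. v x / u x)) \<le> eintegral \<mu> (\<lambda>x. v x / u x)"
    using assms by (intro INF_lower2[of "(u, v)"]) auto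
  then show ?thesis by (simp add: dv_rate_def)
qed

text \<open>The upper bound on \<open>h\<close> makes the positive part integrable and excludes
  \<open>\<infinity> - \<infinity>\<close>. Either the negative part diverges and the claim is
  trivial, or the extended integral is the ordinary one.\<close>

lemma (in finite_measure) minus_eintegral_ge:
  assumes h [measurable]: "h \<in> borel_measurable M" and bd: "\<And>x. h x \<le> B"
    and le: "integrable M h \<Longrightarrow> r \<le> - (\<integral>x. h x \<partial>M)"
  shows "ereal r \<le> - eintegral M h"
proof -
  have "(\<integral>\<^sup>+x. ennreal (h x) \<partial>M) \<le> (\<integral>\<^sup>+x. ennreal B \<partial>M)"
    using bd by (intro nn_integral_mono ennreal_leI)
  also have "\<dots> < \<infinity>" by (simp add: ennreal_mult_eq_top_iff less_top[symmetric])
  finally have pos: "(\<integral>\<^sup>+x. ennreal (h x) \<partial>M) < \<infinity>" .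
  show ?thesis
  proof (cases "(\<integral>\<^sup>+x. ennreal (- h x) \<partial>M) = \<infinity>")
    case True
    then have "eintegral M h = - \<infinity>"
      unfolding eintegral_def using pos
      by (cases "\<integral>\<^sup>+x. ennreal (h x) \<partial>M" rule: ennreal_cases) auto
    then show ?thesis by simp
  next
    case False
    then have int: "integrable M h"
      using pos by (simp add: real_integrable_def)
    obtain a b where ab: "0 \<le> a" "(\<integral>\<^sup>+x. ennreal (h x) \<partial>M) = ennreal a"
        "0 \<le> b" "(\<integral>\<^sup>+x. ennreal (- h x) \<partial>M) = ennreal b"
      using pos False by (metis ennreal_cases infinity_ennreal_def less_irrefl)
    then have "eintegral M h = ereal (\<integral>x. h x \<partial>M)"
      unfolding eintegral_def real_lebesgue_integral_def[OF int] by simp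
    then show ?thesis using le[OF int] by simp
  qed
qed

lemma (in markov_semigroup) dv_rate_not_absolutely_continuous:
  assumes \<mu>: "\<mu> \<in> PE" and ac: "\<not> absolutely_continuous \<pi> \<mu>"
  shows "dv_rate (generator \<pi> K) \<mu> = \<infinity>"
proof (rule ereal_top)
  fix B
  interpret \<mu>: prob_space \<mu> using \<mu> by (simp add: PE_def)
  have sets_mu [simp, measurable_cong]: "sets \<mu> = sets borel" using \<mu> by (simp add: PE_def)
  obtain N where N: "N \<in> null_sets \<pi>" "N \<notin> null_sets \<mu>"
    using ac by (auto simp: absolutely_continuous_def)
  then have Nb [measurable]: "N \<in> sets borel" by auto
  then have pos: "0 < \<mu>.prob N"
    using N by (auto simp: null_sets_def \<mu>.emeasure_eq_measure zero_less_measure_iff)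
  \<comment> \<open>Chosen so that the test pair contributes exactly \<open>\<bar>B\<bar>\<close> to
    the rate, for arbitrary \<open>B\<close>.\<close>
  define a where "a = \<bar>B\<bar> / \<mu>.prob N"
  have a: "0 \<le> a" using pos by (simp add: a_def)
  define v where "v x = - a * indicator N x" for x
  have vm [measurable]: "v \<in> borel_measurable borel" unfolding v_def[abs_def] by measurable
  have "AE x in \<pi>. x \<notin> N" using N(1) by (rule AE_not_in)
  then have "AE x in \<pi>. v x = 0" by eventually_elim (simp add: v_def)
  with vm have gen: "(\<lambda>_. 1, v) \<in> generator \<pi> K" by (rule generator_one)
  have "(\<integral>x. v x \<partial>\<mu>) = - a * \<mu>.prob N" unfolding v_def[abs_def] by simp
  also have "\<dots> = - \<bar>B\<bar>" using pos by (simp add: a_def)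
  finally have vint: "(\<integral>x. v x \<partial>\<mu>) = - \<bar>B\<bar>" .
  have "ereal B \<le> - eintegral \<mu> (\<lambda>x. v x / 1)"
  proof (rule \<mu>.minus_eintegral_ge)
    show "v x / 1 \<le> 0" for x using a by (simp add: v_def)
  qed (simp_all add: vint)
  also have "\<dots> \<le> dv_rate (generator \<pi> K) \<mu>"
    using dv_rate_ge[OF gen, of \<mu>] by simp
  finally show "ereal B \<le> dv_rate (generator \<pi> K) \<mu>" .
qed

text \<open>
  Testing with \<open>u + \<epsilon>\<close> where \<open>L u = r (u - g)\<close> works because
  \<open>(g - u) g\<^sup>2 - (g - u) u\<^sup>2 = (g - u)\<^sup>2 (g + u) \<ge> 0\<close>.
\<close>

lemma dv_rate_ge_energy:
  fixes \<pi> :: "'a::polish_space measure"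
  assumes \<pi>: "prob_space \<pi>" "sets \<pi> = sets borel" and \<mu>: "\<mu> \<in> PE"
    and g: "g \<in> L2 \<pi>" "\<And>x. 0 \<le> g x" and dens: "\<mu> = density \<pi> (\<lambda>x. ennreal ((g x)\<^sup>2))"
    and r: "0 < r" and u: "u \<in> L2 \<pi>" "\<And>x. 0 \<le> u x"
    and L: "\<And>e. 0 < e \<Longrightarrow> (\<lambda>x. u x + e, \<lambda>x. r * (u x - g x)) \<in> L"
  shows "ereal (- ip \<pi> u (\<lambda>x. r * (u x - g x))) \<le> dv_rate L \<mu>"
proof -
  interpret \<pi>: prob_space \<pi> by fact
  interpret \<mu>: prob_space \<mu> using \<mu> by (simp add: PE_def)
  have [measurable_cong]: "sets \<mu> = sets \<pi>" using \<mu> \<pi> by (simp add: PE_def)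
  have [measurable]: "g \<in> borel_measurable \<pi>" "u \<in> borel_measurable \<pi>"
    using g u by (auto intro: L2_measurable)
  \<comment> \<open>The integrand of the variational formula with weight \<open>u^2\<close> in place
    of \<open>g^2\<close>. Since \<open>u^2 / (u + e) \<le> u\<close>, it is dominated uniformly in
    \<open>e\<close> by \<open>B\<close>, a product of two \<open>L2\<close> functions; the weight
    \<open>g^2\<close> offers no such bound.\<close>
  define w where "w e x = r * (g x - u x) * (u x)\<^sup>2 / (u x + e)" for e x
  define B where "B x = r * (\<bar>g x - u x\<bar> * u x)" for x
  have B_int: "integrable \<pi> B"
  proof -
    have "(\<lambda>x. \<bar>g x - u x\<bar>) \<in> L2 \<pi>" using L2_diff[OF g(1) u(1)] by (simp add: L2_def)
    then show ?thesis unfolding B_def by (intro integrable_mult_right L2_ip_integrable u)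
  qed
  have w_le: "\<bar>w e x\<bar> \<le> B x" if "0 < e" for e x
  proof -
    have "(u x)\<^sup>2 / (u x + e) \<le> u x"
      using u(2)[of x] that by (simp add: divide_le_eq power2_eq_square distrib_left)
    then have "r * \<bar>g x - u x\<bar> * ((u x)\<^sup>2 / (u x + e)) \<le> r * \<bar>g x - u x\<bar> * u x"
      using r by (intro mult_left_mono) auto
    then show ?thesis
      using r u(2)[of x] that by (simp add: w_def B_def abs_mult)
  qed
  have w_int: "integrable \<pi> (w e)" if "0 < e" for e
  proof (rule Bochner_Integration.integrable_bound[OF B_int])
    show "w e \<in> borel_measurable \<pi>" unfolding w_def[abs_def] by measurable
    show "AE x in \<pi>. norm (w e x) \<le> norm (B x)"
      using w_le[OF that] by (auto intro: order_trans[OF _ abs_ge_self])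
  qed
  have le: "ereal (\<integral>x. w e x \<partial>\<pi>) \<le> dv_rate L \<mu>" if e: "0 < e" for e
  proof -
    define h where "h x = r * (u x - g x) / (u x + e)" for x
    have ue: "0 < u x + e" for x using u(2)[of x] e by linarith
    have hm [measurable]: "h \<in> borel_measurable \<pi>" unfolding h_def[abs_def] by measurable
    have "ereal (\<integral>x. w e x \<partial>\<pi>) \<le> - eintegral \<mu> h"
    proof (rule \<mu>.minus_eintegral_ge)
      show "h \<in> borel_measurable \<mu>" by measurable
      \<comment> \<open>From \<open>u - g \<le> u + e\<close>. This one-sided bound is what keeps
        the extended integral meaningful without integrability of \<open>h\<close>.\<close>
      show "h x \<le> r" for x
      proof -
        have "r * (u x - g x) \<le> r * (u x + e)" using r e g(2)[of x] by (intro mult_left_mono) auto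
        then show ?thesis using ue[of x] by (simp add: h_def divide_le_eq)
      qed
      assume "integrable \<mu> h"
      then have hi: "integrable \<pi> (\<lambda>x. (g x)\<^sup>2 * h x)"
        unfolding dens by (subst (asm) integrable_density) auto
      have "(\<integral>x. w e x \<partial>\<pi>) \<le> (\<integral>x. - ((g x)\<^sup>2 * h x) \<partial>\<pi>)"
      proof (rule integral_mono[OF w_int[OF e] integrable_minus[OF hi]])
        fix x
        have "- ((g x)\<^sup>2 * h x) - w e x =
            (- ((g x)\<^sup>2 * (r * (u x - g x))) - r * (g x - u x) * (u x)\<^sup>2) / (u x + e)"
          by (simp add: h_def w_def diff_divide_distrib)
        also have "- ((g x)\<^sup>2 * (r * (u x - g x))) - r * (g x - u x) * (u x)\<^sup>2 =
            r * ((g x - u x)\<^sup>2 * (g x + u x))"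
          by (simp add: power2_eq_square algebra_simps)
        finally have "0 \<le> - ((g x)\<^sup>2 * h x) - w e x"
          using r ue[of x] g(2)[of x] u(2)[of x] by simp
        then show "w e x \<le> - ((g x)\<^sup>2 * h x)" by simp
      qed
      also have "\<dots> = - (\<integral>x. h x \<partial>\<mu>)"
        unfolding dens by (subst integral_density) auto
      finally show "(\<integral>x. w e x \<partial>\<pi>) \<le> - (\<integral>x. h x \<partial>\<mu>)" .
    qed
    also have "\<dots> \<le> dv_rate L \<mu>"
      using dv_rate_ge[OF L[OF e] ue] by (simp add: h_def[abs_def])
    finally show ?thesis .
  qed
  have lim: "(\<lambda>n. \<integral>x. w (1 / real (Suc n)) x \<partial>\<pi>) \<longlonglongrightarrow> (\<integral>x. r * (g x - u x) * u x \<partial>\<pi>)"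
  proof (rule integral_dominated_convergence[OF _ _ B_int])
    show "w (1 / real (Suc n)) \<in> borel_measurable \<pi>" for n unfolding w_def[abs_def] by measurable
    show "AE x in \<pi>. norm (w (1 / real (Suc n)) x) \<le> B x" for n using w_le by simp
    \<comment> \<open>Where \<open>u x = 0\<close> the sequence and its limit are identically 0;
      elsewhere the denominator tends to \<open>u x\<close>, which is nonzero.\<close>
    have "(\<lambda>n. w (1 / real (Suc n)) x) \<longlonglongrightarrow> r * (g x - u x) * u x" for x
    proof (cases "u x = 0")
      case False
      have lim0: "(\<lambda>n. 1 / real (Suc n)) \<longlonglongrightarrow> 0" using LIMSEQ_Suc[OF lim_1_over_n] by simp
      have "(\<lambda>n. r * (g x - u x) * (u x)\<^sup>2 / (u x + 1 / real (Suc n))) \<longlonglongrightarrow>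
          r * (g x - u x) * (u x)\<^sup>2 / (u x + 0)"
        using False by (intro tendsto_intros lim0) simp
      then show ?thesis using False by (simp add: w_def power2_eq_square mult.assoc)
    qed (simp add: w_def)
    then show "AE x in \<pi>. (\<lambda>n. w (1 / real (Suc n)) x) \<longlonglongrightarrow> r * (g x - u x) * u x" by simp
  qed measurable
  have "ereal (\<integral>x. r * (g x - u x) * u x \<partial>\<pi>) \<le> dv_rate L \<mu>"
    by (rule LIMSEQ_le_const2[OF tendsto_ereal[OF lim]]) (use le in auto)
  also have "(\<integral>x. r * (g x - u x) * u x \<partial>\<pi>) = - ip \<pi> u (\<lambda>x. r * (u x - g x))"
    unfolding ip_def integral_minus[symmetric]
    by (rule Bochner_Integration.integral_cong) (simp_all add: algebra_simps)
  finally show ?thesis .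
qed

section \<open>Square-root densities and the comparison of the rates\<close>

lemma RN_deriv_sqrt_density:
  assumes "prob_space \<pi>" "prob_space \<mu>" "sets \<mu> = sets \<pi>" "absolutely_continuous \<pi> \<mu>"
  defines "g \<equiv> \<lambda>x. sqrt (enn2real (RN_deriv \<pi> \<mu> x))"
  shows "\<mu> = density \<pi> (\<lambda>x. ennreal ((g x)\<^sup>2))" and "g \<in> L2 \<pi>"
proof -
  interpret \<pi>: prob_space \<pi> by fact
  interpret \<mu>: prob_space \<mu> by fact
  \<comment> \<open>\<open>enn2real\<close> sends infinity to 0, so \<open>g^2\<close> is a version
    of the density only once infinite values are known to be negligible.\<close>
  have "AE x in \<pi>. RN_deriv \<pi> \<mu> x \<noteq> \<infinity>"
    using assms by (intro \<pi>.RN_deriv_finite) unfold_locales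
  then have "AE x in \<pi>. RN_deriv \<pi> \<mu> x = ennreal ((g x)\<^sup>2)"
    by eventually_elim (simp add: g_def less_top)
  then have "density \<pi> (RN_deriv \<pi> \<mu>) = density \<pi> (\<lambda>x. ennreal ((g x)\<^sup>2))"
    by (intro density_cong) (auto simp: g_def)
  then show dens: "\<mu> = density \<pi> (\<lambda>x. ennreal ((g x)\<^sup>2))"
    using \<pi>.density_RN_deriv[of \<mu>] assms by simp
  have gm [measurable]: "g \<in> borel_measurable \<pi>" unfolding g_def by measurable
  have "(\<integral>\<^sup>+x. ennreal ((g x)\<^sup>2) \<partial>\<pi>) = emeasure (density \<pi> (\<lambda>x. ennreal ((g x)\<^sup>2))) (space \<pi>)"
    by (subst emeasure_density) (auto intro!: nn_integral_cong)
  also have "\<dots> = 1"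
    using \<mu>.emeasure_space_1 sets_eq_imp_space_eq[OF assms(3)] by (simp flip: dens)
  finally show "g \<in> L2 \<pi>" unfolding L2_def by (auto intro!: integrableI_nonneg)
qed

text \<open>Two semigroups enter: that of the full generator supplies the resolvents to be tested,
  that of \<open>L0\<close> makes the energy nonnegative and its graph linear.\<close>

lemma dv_rate_ge_reversible_rate:
  fixes \<pi> :: "'a::polish_space measure"
  assumes L0: "markov_generator \<pi> K0 L0" and L: "markov_generator \<pi> K (op_sum (op_sum L0 S) A)"
    and S: "S \<subseteq> L2 \<pi> \<times> L2 \<pi>" "\<And>u v. (u, v) \<in> S \<Longrightarrow> ip \<pi> u v \<le> 0"
    and A: "A \<subseteq> L2 \<pi> \<times> L2 \<pi>" "\<And>u v. (u, v) \<in> A \<Longrightarrow> ip \<pi> u v = 0"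
    and \<mu>: "\<mu> \<in> PE"
  shows "reversible_rate \<pi> L0 \<mu> \<le> dv_rate (op_sum (op_sum L0 S) A) \<mu>"
proof -
  interpret m0: markov_semigroup \<pi> K0
    using L0 by unfold_locales (simp_all add: markov_generator_def)
  interpret m: continuous_markov_semigroup \<pi> K
    using L by unfold_locales (simp_all add: markov_generator_def)
  have genL0: "L0 = generator \<pi> K0" using L0 by (simp add: markov_generator_def)
  have genL: "op_sum (op_sum L0 S) A = generator \<pi> K" using L by (simp add: markov_generator_def)
  show ?thesis
  proof (cases "absolutely_continuous \<pi> \<mu>")
    case False
    then show ?thesis
      using m.dv_rate_not_absolutely_continuous[OF \<mu>] by (simp add: genL)
  next
    case True
    define g where "g = (\<lambda>x. sqrt (enn2real (RN_deriv \<pi> \<mu> x)))"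
    have \<mu>': "prob_space \<mu>" "sets \<mu> = sets \<pi>" using \<mu> by (simp_all add: PE_def)
    have dens: "\<mu> = density \<pi> (\<lambda>x. ennreal ((g x)\<^sup>2))" and gL2: "g \<in> L2 \<pi>"
      unfolding g_def by (rule RN_deriv_sqrt_density[OF m0.prob_space_axioms \<mu>' True])+
    have g0: "0 \<le> g x" for x by (simp add: g_def)
    have energy: "ereal (- ip \<pi> (m.resolvent r g) (\<lambda>x. r * (m.resolvent r g x - g x))) \<le>
        dv_rate (op_sum (op_sum L0 S) A) \<mu>" if r: "0 < r" for r
    proof (rule dv_rate_ge_energy[OF m0.prob_space_axioms m.sets_pi \<mu> gL2 g0 dens r])
      show "m.resolvent r g \<in> L2 \<pi>" using r gL2 by (rule m.resolvent_L2)
      show "0 \<le> m.resolvent r g x" for x using r g0 by (rule m.resolvent_nonneg)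
      \<comment> \<open>Adds \<open>e\<close> times the pair \<open>(1, 0)\<close> to the resolvent
        pair, so the image under the generator is unchanged.\<close>
      show "(\<lambda>x. m.resolvent r g x + e, \<lambda>x. r * (m.resolvent r g x - g x)) \<in> op_sum (op_sum L0 S) A" for e
        using m.generator_lincomb[OF m.resolvent_generator[OF r gL2 g0] m.generator_one[of "\<lambda>_. 0"], of 1 e]
        by (simp add: genL)
    qed
    \<comment> \<open>Bounding by every real \<open>c\<close> above the rate suffices, and an
      infinite rate leaves nothing to show.\<close>
    have "form_closure \<pi> L0 g \<le> dv_rate (op_sum (op_sum L0 S) A) \<mu>"
    proof (rule ereal_le_real)
      fix c assume c: "dv_rate (op_sum (op_sum L0 S) A) \<mu> \<le> ereal c"
      show "form_closure \<pi> L0 g \<le> ereal c"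
      proof (rule form_closure_le)
        show "L0 \<subseteq> L2 \<pi> \<times> L2 \<pi>" unfolding genL0 by (rule m0.generator_L2)
        show "(\<lambda>x. a * u x + b * u' x, \<lambda>x. a * v x + b * v' x) \<in> L0"
          if "(u, v) \<in> L0" "(u', v') \<in> L0" for u v u' v' a b
          using that unfolding genL0 by (rule m0.generator_lincomb)
        show "ip \<pi> u v \<le> 0" if "(u, v) \<in> L0" for u v
          using that unfolding genL0 by (rule m0.generator_dissipative)
        fix e :: real assume "0 < e"
        then obtain r where r: "0 < r" "l2norm \<pi> (\<lambda>x. m.resolvent r g x - g x) \<le> e"
          using m.resolvent_approx[OF gL2 g0] by blast
        let ?u = "m.resolvent r g"
        have "(?u, \<lambda>x. r * (?u x - g x)) \<in> op_sum (op_sum L0 S) A"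
          unfolding genL using r(1) gL2 g0 by (rule m.resolvent_generator)
        \<comment> \<open>The graph of a sum contains only functions common to the domains of its
          summands, so the energy at the resolvent splits into three finite inner products.\<close>
        then obtain v s a where v: "(?u, v) \<in> L0" and s: "(?u, s) \<in> S" and a: "(?u, a) \<in> A"
          and eq: "(\<lambda>x. r * (?u x - g x)) = (\<lambda>x. (v x + s x) + a x)"
          unfolding op_sum_def by auto
        have L2: "?u \<in> L2 \<pi>" "v \<in> L2 \<pi>" "s \<in> L2 \<pi>" "a \<in> L2 \<pi>"
          using v s a S(1) A(1) m0.generator_L2 by (auto simp: genL0)
        have "ip \<pi> ?u (\<lambda>x. r * (?u x - g x)) = ip \<pi> ?u v + ip \<pi> ?u s + ip \<pi> ?u a"
          unfolding eq using ip_lincomb_right[OF L2_add[OF L2(2,3)] L2(4,1), of 1 1]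
            ip_lincomb_right[OF L2(2,3,1), of 1 1] by simp
        then have "- ip \<pi> ?u v \<le> - ip \<pi> ?u (\<lambda>x. r * (?u x - g x))"
          using S(2)[OF s] A(2)[OF a] by simp
        also have "\<dots> \<le> c" using order_trans[OF energy[OF r(1)] c] by simp
        finally show "\<exists>u v. (u, v) \<in> L0 \<and> l2norm \<pi> (\<lambda>x. u x - g x) \<le> e \<and> - ip \<pi> u v \<le> c"
          using v r(2) by blast
      qed (rule gL2)
    qed
    then show ?thesis using True by (simp add: reversible_rate_def g_def)
  qed
qed

theorem lemma4:
  fixes \<pi> :: "'a::polish_space measure"
    and L0 S A :: "'a l2op"
    and K0 K1 K :: "real \<Rightarrow> 'a \<Rightarrow> 'a measure"
    and M0 :: "'w0 measure" and X0 :: "real \<Rightarrow> 'w0 \<Rightarrow> 'a"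
    and M1 :: "'w1 measure" and X1 :: "real \<Rightarrow> 'w1 \<Rightarrow> 'a"
    and M :: "'w measure" and X :: "real \<Rightarrow> 'w \<Rightarrow> 'a"
    and I_o I_s I :: "'a measure \<Rightarrow> ereal"
    and \<alpha> l :: real and f :: "'a \<Rightarrow> real"
  assumes "markov_generator \<pi> K0 L0"
    and "reversible \<pi> K0" and "ergodic \<pi> K0" and "spectral_gap \<pi> L0"
    and "reversible_perturbation \<pi> L0 S"
    and "irreversible_perturbation \<pi> (op_sum L0 S) A"
    and "markov_generator \<pi> K1 (op_sum L0 S)"
    and "markov_generator \<pi> K (op_sum (op_sum L0 S) A)"
    and "markov_process M0 X0 K0" and "ldp M0 (empirical_measure X0) I_o"
    and "\<And>\<mu>. \<mu> \<in> PE \<Longrightarrow> I_o \<mu> = dv_rate L0 \<mu>"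
    and "\<And>\<mu>. \<mu> \<in> PE \<Longrightarrow> I_o \<mu> = reversible_rate \<pi> L0 \<mu>"
    and "markov_process M1 X1 K1" and "ldp M1 (empirical_measure X1) I_s"
    and "\<And>\<mu>. \<mu> \<in> PE \<Longrightarrow> I_s \<mu> = dv_rate (op_sum L0 S) \<mu>"
    and "\<And>\<mu>. \<mu> \<in> PE \<Longrightarrow> I_s \<mu> = reversible_rate \<pi> (op_sum L0 S) \<mu>"
    and "markov_process M X K" and "ldp M (empirical_measure X) I"
    and "\<And>\<mu>. \<mu> \<in> PE \<Longrightarrow> I \<mu> = dv_rate (op_sum (op_sum L0 S) A) \<mu>"
    and "0 < \<alpha>" and "holder \<alpha> f"
    and "(INF x. ereal (f x)) < ereal l" and "ereal l < (SUP x. ereal (f x))"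
    and "integrable \<pi> f \<longrightarrow> l \<noteq> (\<integral>x. f x \<partial>\<pi>)"
  shows "observable_rate I f l \<ge> observable_rate I_o f l"
proof -
  have S: "S \<subseteq> L2 \<pi> \<times> L2 \<pi>" and S_le: "\<And>u v. (u, v) \<in> S \<Longrightarrow> ip \<pi> u v \<le> 0"
    using assms(5) by (auto simp: reversible_perturbation_def self_adjoint_def linear_op_def)
  have A: "A \<subseteq> L2 \<pi> \<times> L2 \<pi>"
    using assms(6) by (simp add: irreversible_perturbation_def linear_op_def)
  have A_0: "ip \<pi> u v = 0" if "(u, v) \<in> A" for u v
  proof -
    have "ip \<pi> u v = - ip \<pi> v u"
      using assms(6) that unfolding irreversible_perturbation_def by blast
    then show ?thesis by (simp add: ip_commute[of \<pi> v u])
  qed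
  \<comment> \<open>The reference rate enters through its closed form and the perturbed one through
    the variational formula. Both infima have the same constraint set, so the comparison at each
    \<open>\<mu>\<close> carries over.\<close>
  have "I_o \<mu> \<le> I \<mu>" if "\<mu> \<in> PE" for \<mu>
    unfolding assms(12)[OF that] assms(19)[OF that]
    using assms(1,8) S S_le A A_0 that by (rule dv_rate_ge_reversible_rate)
  then show ?thesis
    unfolding observable_rate_def by (intro INF_mono) auto
qed

end
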